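(* Let $G=(V,E,W_E)$ be a connected weighted graph. Let $d_i$ and $d_j$ be two cost-dominated path-representable distances on $G$, given by path choice functions $g_i$ and $g_j$ respectively. If $d_i(v,w)\le d_j(v,w)$ for all vertices $v,w\in V$, then there exists an injective function $\varphi_{i,j}:\mathbf{bcd}_1(d_i)\rightarrow\mathbf{bcd}_1(d_j)$ of the form $\varphi_{i,j}([\beta,\delta])=[\beta,\delta']$ with $\delta\le\delta'$ for every $[\beta,\delta]\in\mathbf{bcd}_1(d_i)$.
   Context: A weighted graph $G=(V,E,W_E)$ is a finite simple undirected graph with a function $W_E:E\to\mathbb{R}^{>0}$. Path choice function: for $v,w\in V$ let $P(v,w)$ be the set of paths from $v$ to $w$ with no repeated vertex, and $\mathcal{P}=\bigcup_{v,w\in V}P(v,w)$. A path choice function on $G$ is a function $g:V\times V\to\mathcal{P}$ with $g(v,w)\in P(v,w)$ for all $v,w$ and such that $g(a,b)\subseteq g(v,w)$ for all $v,w\in V$ and all vertices $a,b$ on $g(v,w)$ (consistency; $\subseteq$ means subpath). Path-representable distance: $d:V\times V\to\mathbb{R}$ is path-representable (by $g$) if there is a path choice function $g$ with $d(v,w)=\sum_{e\in g(v,w)}W_E(e)$ for $v\ne w$ and $d(v,v)=0$. Cost-dominated: $g$ is cost-dominated if for every edge $e=(v,w)\in E$ such that $g(v,w)\neq e$ (the chosen path is not the single edge $e$), $W_E(e)\ge\sum_{e'\in g(v,w)}W_E(e')$. A path-representable distance is cost-dominated if the path choice function $g$ representing it is. Barcode: for a distance $d$ on $V$, let $\mathbb{X}$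 be the full simplicial complex on $V$ (all nonempty subsets of $V$), and let $f:\mathbb{X}\to\mathbb{R}$ be $f(\sigma)=\max\{d(v,w)\mid v,w\in\sigma\}$ if $\dim\sigma\ge1$ and $f(\sigma)=0$ if $\sigma$ is a vertex. The sublevel complexes $\mathbb{X}_t=f^{-1}((-\infty,t])$ form the Vietoris--Rips filtration. $\mathbf{bcd}_k(d)$ is its $k$-dimensional persistence barcode with coefficients in $\mathbb{Z}/2\mathbb{Z}$: the multiset of intervals $[\beta,\delta]$ (birth, death) with $\beta<\delta$ (zero-length intervals are not included). Functions between barcodes are functions between multisets, i.e. elements are counted with multiplicity and injectivity is understood for elements counted with multiplicity. *)

theory Defs
  imports Complex_Main "HOL-Library.Multiset" "HOL-Library.Extended_Real"
    "HOL-Library.Z2" "HOL-Library.Function_Algebras"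
begin

definition weighted_graph :: "'a set \<Rightarrow> 'a set set \<Rightarrow> ('a set \<Rightarrow> real) \<Rightarrow> bool" where
  "weighted_graph V E W \<longleftrightarrow>
     finite V \<and> (\<forall>e\<in>E. e \<subseteq> V \<and> card e = 2) \<and> (\<forall>e\<in>E. 0 < W e)"

text \<open>A path without repeated vertex is given by its list of vertices; the one-vertex list is the
  trivial path.\<close>

definition simple_paths :: "'a set \<Rightarrow> 'a set set \<Rightarrow> 'a \<Rightarrow> 'a \<Rightarrow> 'a list set" where
  "simple_paths V E v w =
     {p. p \<noteq> [] \<and> set p \<subseteq> V \<and> distinct p \<and> successively (\<lambda>a b. {a, b} \<in> E) p
         \<and> hd p = v \<and> last p = w}"

definition connected_graph :: "'a set \<Rightarrow> 'a set set \<Rightarrow> bool" where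
  "connected_graph V E \<longleftrightarrow> (\<forall>v\<in>V. \<forall>w\<in>V. simple_paths V E v w \<noteq> {})"

definition path_edges :: "'a list \<Rightarrow> 'a set set" where
  "path_edges p = {{p ! i, p ! Suc i} | i. Suc i < length p}"

text \<open>Subpaths are taken in the undirected sense. The vertices \<open>a\<close>, \<open>b\<close> in the consistency
  condition below may be met in either order along \<open>g v w\<close>; in particular \<open>g w v\<close> has to be a
  subpath of \<open>g v w\<close>, that is, its reversal.\<close>

definition subpath :: "'a list \<Rightarrow> 'a list \<Rightarrow> bool" where
  "subpath q p \<longleftrightarrow> set q \<subseteq> set p \<and> path_edges q \<subseteq> path_edges p"

definition path_choice_function ::
    "'a set \<Rightarrow> 'a set set \<Rightarrow> ('a \<Rightarrow> 'a \<Rightarrow> 'a list) \<Rightarrow> bool" where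
  "path_choice_function V E g \<longleftrightarrow>
     (\<forall>v\<in>V. \<forall>w\<in>V. g v w \<in> simple_paths V E v w) \<and>
     (\<forall>v\<in>V. \<forall>w\<in>V. \<forall>a\<in>set (g v w). \<forall>b\<in>set (g v w). subpath (g a b) (g v w))"

definition path_weight :: "('a set \<Rightarrow> real) \<Rightarrow> 'a list \<Rightarrow> real" where
  "path_weight W p = (\<Sum>e\<in>path_edges p. W e)"

definition path_represented_by ::
    "'a set \<Rightarrow> 'a set set \<Rightarrow> ('a set \<Rightarrow> real) \<Rightarrow> ('a \<Rightarrow> 'a \<Rightarrow> real) \<Rightarrow> ('a \<Rightarrow> 'a \<Rightarrow> 'a list) \<Rightarrow> bool" where
  "path_represented_by V E W d g \<longleftrightarrow>
     path_choice_function V E g \<and>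
     (\<forall>v\<in>V. \<forall>w\<in>V. d v w = (if v = w then 0 else path_weight W (g v w)))"

definition cost_dominated ::
    "'a set set \<Rightarrow> ('a set \<Rightarrow> real) \<Rightarrow> ('a \<Rightarrow> 'a \<Rightarrow> 'a list) \<Rightarrow> bool" where
  "cost_dominated E W g \<longleftrightarrow>
     (\<forall>v w. {v, w} \<in> E \<and> g v w \<noteq> [v, w] \<longrightarrow> W {v, w} \<ge> path_weight W (g v w))"

definition rips_value :: "('a \<Rightarrow> 'a \<Rightarrow> real) \<Rightarrow> 'a set \<Rightarrow> real" where
  "rips_value d \<sigma> = (if card \<sigma> = 1 then 0 else Max {d v w | v w. v \<in> \<sigma> \<and> w \<in> \<sigma>})"

definition rips_complex :: "'a set \<Rightarrow> ('a \<Rightarrow> 'a \<Rightarrow> real) \<Rightarrow> real \<Rightarrow> 'a set set" where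
  "rips_complex V d t = {\<sigma>. \<sigma> \<noteq> {} \<and> \<sigma> \<subseteq> V \<and> rips_value d \<sigma> \<le> t}"

definition chains :: "nat \<Rightarrow> 'a set set \<Rightarrow> ('a set \<Rightarrow> bit) set" where
  "chains k X = {c. \<forall>\<sigma>. c \<sigma> \<noteq> 0 \<longrightarrow> \<sigma> \<in> X \<and> card \<sigma> = Suc k}"

text \<open>The empty face is excluded: homology is not reduced.\<close>

definition boundary :: "('a set \<Rightarrow> bit) \<Rightarrow> 'a set \<Rightarrow> bit" where
  "boundary c = (\<lambda>\<tau>. if \<tau> = {} then 0
                     else \<Sum>\<sigma> | c \<sigma> \<noteq> 0 \<and> (\<exists>v\<in>\<sigma>. \<tau> = \<sigma> - {v}). c \<sigma>)"

definition cycles :: "nat \<Rightarrow> 'a set set \<Rightarrow> ('a set \<Rightarrow> bit) set" where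
  "cycles k X = {c \<in> chains k X. boundary c = 0}"

definition boundaries :: "nat \<Rightarrow> 'a set set \<Rightarrow> ('a set \<Rightarrow> bit) set" where
  "boundaries k X = boundary ` chains (Suc k) X"

text \<open>An isomorphism from a finite direct sum of interval modules, the \<open>i\<close>-th one supported on
  \<open>b i \<le> t < e i\<close>, to the persistence module \<open>t \<mapsto> H\<^sub>k(X t; Z/2)\<close>, where \<open>H\<^sub>k\<close> is \<open>cycles\<close> modulo
  \<open>boundaries\<close> and the structure maps are induced by inclusion. It is given by the images
  \<open>[z i] \<in> H\<^sub>k(X (b i))\<close> of the generators: the class of \<open>z i\<close> vanishes from \<open>e i\<close> on, and at every
  \<open>t\<close> the classes of the \<open>z i\<close> alive at \<open>t\<close> form a basis of \<open>H\<^sub>k(X t)\<close>. Linear combinations over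
  Z/2 are sums over subsets \<open>S\<close>. Essential classes have \<open>e i = \<infinity>\<close>.\<close>

definition interval_decomposition ::
    "nat \<Rightarrow> (real \<Rightarrow> 'a set set) \<Rightarrow> nat set \<Rightarrow> (nat \<Rightarrow> real) \<Rightarrow> (nat \<Rightarrow> ereal)
      \<Rightarrow> (nat \<Rightarrow> 'a set \<Rightarrow> bit) \<Rightarrow> bool" where
  "interval_decomposition k X I b e z \<longleftrightarrow>
     finite I \<and>
     (\<forall>i\<in>I. ereal (b i) < e i \<and> z i \<in> cycles k (X (b i)) \<and>
            (\<forall>t. e i \<le> ereal t \<longrightarrow> z i \<in> boundaries k (X t))) \<and>
     (\<forall>t. \<forall>c\<in>cycles k (X t). \<exists>!S. S \<subseteq> {i \<in> I. b i \<le> t \<and> ereal t < e i} \<and>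
            c - (\<Sum>i\<in>S. z i) \<in> boundaries k (X t))"

definition is_barcode :: "nat \<Rightarrow> (real \<Rightarrow> 'a set set) \<Rightarrow> (real \<times> ereal) multiset \<Rightarrow> bool" where
  "is_barcode k X M \<longleftrightarrow>
     (\<exists>I b e z. interval_decomposition k X I b e z \<and>
                M = image_mset (\<lambda>i. (b i, e i)) (mset_set I))"

definition bcd :: "nat \<Rightarrow> 'a set \<Rightarrow> ('a \<Rightarrow> 'a \<Rightarrow> real) \<Rightarrow> (real \<times> ereal) multiset" where
  "bcd k V d = (THE M. is_barcode k (rips_complex V d) M)"

text \<open>The elements of a multiset counted with multiplicity: \<open>(x, n)\<close> is the \<open>n\<close>-th copy of \<open>x\<close>.\<close>

definition mset_copies :: "'b multiset \<Rightarrow> ('b \<times> nat) set" where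
  "mset_copies M = {(x, n). n < count M x}"

end

theory Submission
  imports Defs
begin

text \<open>Since \<open>d\<^sub>i \<le> d\<^sub>j\<close>, the Rips complex of \<open>d\<^sub>j\<close> at scale \<open>t\<close> is contained in that of \<open>d\<^sub>i\<close>. The induced
  map on \<open>H\<^sub>1\<close> is onto: the vertices of the path \<open>g\<^sub>i v w\<close> span a simplex at scale \<open>d\<^sub>i v w\<close>, so the
  edge \<open>{v, w}\<close> is homologous to the path, and every edge \<open>e\<close> of the path has
  \<open>d\<^sub>j\<close>-length at most \<open>W e \<le> d\<^sub>i v w\<close>. An epimorphism of persistence modules can only lower,
  for each birth \<open>\<beta>\<close> and each time \<open>t\<close>, the number of bars born at \<open>\<beta>\<close> and alive at \<open>t\<close>; these
  inequalities yield the injection. Applied to the identity they show that the barcode is unique,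
  and it exists because a finite vector space has a basis adapted to both the filtration by cycles
  and the filtration by boundaries.\<close>

section \<open>Chains with coefficients in Z/2\<close>

lemma bit_fun_add_self [simp]: "(c :: 'b \<Rightarrow> bit) + c = 0"
  by (rule ext) (simp )

lemma bit_fun_diff: "(c :: 'b \<Rightarrow> bit) - d = c + d"
  by (rule ext) simp

text \<open>Finiteness of the chain space supplies the minima and the maximal set used in the greedy
  construction of a basis.\<close>

lemma finite_chains:
  assumes "finite V"
  shows "finite (chains k (Pow V))"
proof (rule finite_subset)
  show "chains k (Pow V) \<subseteq> {f. \<forall>x. (x \<in> Pow V \<longrightarrow> f x \<in> UNIV) \<and> (x \<notin> Pow V \<longrightarrow> f x = 0)}"
    unfolding chains_def by auto (meson subsetD)
  have "(UNIV :: bit set) \<subseteq> {0, 1}"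
    by (metis bit_not_zero_iff insertCI subsetI)
  then have "finite (UNIV :: bit set)"
    by (rule finite_subset) simp
  then show "finite {f :: 'a set \<Rightarrow> bit. \<forall>x. (x \<in> Pow V \<longrightarrow> f x \<in> UNIV) \<and> (x \<notin> Pow V \<longrightarrow> f x = 0)}"
    using assms by (intro finite_set_of_finite_funs) auto
qed

lemma chains_mono: "X \<subseteq> Y \<Longrightarrow> chains k X \<subseteq> chains k Y"
  unfolding chains_def by auto

lemma chains_zero: "0 \<in> chains k X"
  unfolding chains_def by simp

lemma chains_add: "c \<in> chains k X \<Longrightarrow> c' \<in> chains k X \<Longrightarrow> c + c' \<in> chains k X"
  unfolding chains_def by auto

text \<open>The index set in \<open>boundary\<close> depends on the support of \<open>c\<close>.
  Summing over all cofaces inside \<open>V\<close> instead gives an index set independent of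
  \<open>c\<close>, which makes additivity visible.\<close>

lemma boundary_eq_sum:
  assumes "finite V" "c \<in> chains k (Pow V)"
  shows "boundary c \<tau> = (if \<tau> = {} then 0 else \<Sum>\<sigma> | \<sigma> \<subseteq> V \<and> (\<exists>v\<in>\<sigma>. \<tau> = \<sigma> - {v}). c \<sigma>)"
proof -
  have "finite {\<sigma>. \<sigma> \<subseteq> V \<and> (\<exists>v\<in>\<sigma>. \<tau> = \<sigma> - {v})}"
    using assms(1) by simp
  then have "(\<Sum>\<sigma> | c \<sigma> \<noteq> 0 \<and> (\<exists>v\<in>\<sigma>. \<tau> = \<sigma> - {v}). c \<sigma>) =
      (\<Sum>\<sigma> | \<sigma> \<subseteq> V \<and> (\<exists>v\<in>\<sigma>. \<tau> = \<sigma> - {v}). c \<sigma>)"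
    using assms(2) by (intro sum.mono_neutral_left) (auto simp: chains_def)
  then show ?thesis
    unfolding boundary_def by simp
qed

lemma boundary_add:
  assumes "finite V" "c \<in> chains k (Pow V)" "c' \<in> chains k (Pow V)"
  shows "boundary (c + c') = boundary c + boundary c'"
  using boundary_eq_sum[OF assms(1,2)] boundary_eq_sum[OF assms(1,3)]
    boundary_eq_sum[OF assms(1) chains_add[OF assms(2,3)]]
  by (intro ext) (simp only: plus_fun_apply sum.distrib split: if_split, simp)

lemma boundary_zero: "boundary 0 = 0"
  by (rule ext) (simp add: boundary_def)

lemma cycles_zero: "0 \<in> cycles k X"
  by (simp add: cycles_def chains_zero boundary_zero)

lemma boundaries_zero: "0 \<in> boundaries k X"
  unfolding boundaries_def by (rule image_eqI[of _ _ 0]) (simp_all add: boundary_zero chains_zero)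

lemma cycles_mono: "X \<subseteq> Y \<Longrightarrow> cycles k X \<subseteq> cycles k Y"
  using chains_mono unfolding cycles_def by blast

lemma boundaries_mono: "X \<subseteq> Y \<Longrightarrow> boundaries k X \<subseteq> boundaries k Y"
  unfolding boundaries_def by (intro image_mono chains_mono)

lemma cycles_add:
  assumes "finite V" "X \<subseteq> Pow V" "c \<in> cycles k X" "c' \<in> cycles k X"
  shows "c + c' \<in> cycles k X"
proof -
  have "boundary (c + c') = boundary c + boundary c'"
    using assms chains_mono[OF assms(2)] by (intro boundary_add) (auto simp: cycles_def)
  then show ?thesis
    using assms by (simp add: cycles_def chains_add)
qed

lemma boundaries_add:
  assumes "finite V" "X \<subseteq> Pow V" "c \<in> boundaries k X" "c' \<in> boundaries k X"
  shows "c + c' \<in> boundaries k X"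
proof -
  obtain a a' where a: "a \<in> chains (Suc k) X" "c = boundary a" "a' \<in> chains (Suc k) X" "c' = boundary a'"
    using assms by (auto simp: boundaries_def)
  then have "c + c' = boundary (a + a')"
    using assms(1) chains_mono[OF assms(2)] by (subst boundary_add[of V _ "Suc k"]) auto
  then show ?thesis
    using a chains_add unfolding boundaries_def by blast
qed

lemma sum_mem_additive:
  assumes "0 \<in> H" "\<And>x y. x \<in> H \<Longrightarrow> y \<in> H \<Longrightarrow> x + y \<in> H" "\<And>i. i \<in> S \<Longrightarrow> f i \<in> H"
  shows "sum f S \<in> (H :: 'b::comm_monoid_add set)"
  using assms(3) by (induction S rule: infinite_finite_induct) (auto intro: assms(1,2))

section \<open>Bases adapted to two filtrations\<close>

text \<open>Sublevel sets of \<open>v\<close> are closed under addition; the bound on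
  \<open>v 0\<close> covers the empty sum.\<close>

lemma ultrametric_sum:
  fixes v :: "'v::comm_monoid_add \<Rightarrow> 'l::linorder"
  assumes "\<And>x y. v (x + y) \<le> max (v x) (v y)" "finite S" "v 0 \<le> m" "\<And>s. s \<in> S \<Longrightarrow> v s \<le> m"
  shows "v (\<Sum>S) \<le> m"
  using assms(2,4)
proof (induction S)
  case empty then show ?case using assms(3) by simp
next
  case (insert x F)
  then have "v x \<le> m" "v (\<Sum>F) \<le> m" by auto
  then have "v (x + \<Sum>F) \<le> m"
    using order.trans[OF assms(1) max.boundedI] by blast
  then show ?case using insert.hyps by simp
qed

text \<open>Terms over the intersection occur twice and cancel in characteristic 2. With linear
  combinations encoded as subsets, this is addition of coefficient vectors.\<close>

lemma sum_sym_diff: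
  fixes f :: "'i \<Rightarrow> 'v::ab_group_add"
  assumes char2: "\<And>x :: 'v. x + x = 0" and fin: "finite S" "finite T"
  shows "sum f S + sum f T = sum f ((S - T) \<union> (T - S))"
proof -
  have "sum f S + sum f T = sum f (S - T) + sum f (T - S) + (sum f (S \<inter> T) + sum f (S \<inter> T))"
    using sum.Int_Diff[OF fin(1), of f T] sum.Int_Diff[OF fin(2), of f S]
    by (simp add: ac_simps Int_commute)
  also have "\<dots> = sum f (S - T) + sum f (T - S)"
    using char2 by simp
  also have "\<dots> = sum f ((S - T) \<union> (T - S))"
    using fin by (intro sum.union_disjoint[symmetric]) auto
  finally show ?thesis .
qed

text \<open>The basis is built greedily: the next vector is one outside the span of the previous ones
  whose pair of values \<open>(b, e)\<close> is lexicographically minimal.\<close>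

lemma adapted_basis_extend:
  fixes b e :: "'v::ab_group_add \<Rightarrow> 'l::linorder"
  assumes char2: "\<And>x :: 'v. x + x = 0"
    and U: "finite U" "\<And>x y. x \<in> U \<Longrightarrow> y \<in> U \<Longrightarrow> x + y \<in> U"
    and b: "\<And>x y. b (x + y) \<le> max (b x) (b y)" "\<And>x. b 0 \<le> b x"
    and e: "\<And>x y. e (x + y) \<le> max (e x) (e y)" "\<And>x. e 0 \<le> e x"
    and A: "A \<subseteq> U" "\<And>S s. S \<subseteq> A \<Longrightarrow> s \<in> S \<Longrightarrow> \<Sum>S \<noteq> 0 \<and> b s \<le> b (\<Sum>S) \<and> e s \<le> e (\<Sum>S)"
    and greedy: "\<And>y a. y \<in> U \<Longrightarrow> y \<notin> Sum ` Pow A \<Longrightarrow> a \<in> A \<Longrightarrow> b a \<le> b y"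
    and y: "y \<in> U" "y \<notin> Sum ` Pow A"
  obtains x where "x \<in> U" "x \<notin> A"
    "\<And>S s. S \<subseteq> insert x A \<Longrightarrow> s \<in> S \<Longrightarrow> \<Sum>S \<noteq> 0 \<and> b s \<le> b (\<Sum>S) \<and> e s \<le> e (\<Sum>S)"
    "\<And>y a. y \<in> U \<Longrightarrow> y \<notin> Sum ` Pow (insert x A) \<Longrightarrow> a \<in> insert x A \<Longrightarrow> b a \<le> b y"
proof -
  define C where "C = U - Sum ` Pow A"
  have finA: "finite A" using A(1) U(1) finite_subset by blast
  have "finite C" "C \<noteq> {}" using U y unfolding C_def by auto
  then obtain x0 where x0: "x0 \<in> C" "\<And>y. y \<in> C \<Longrightarrow> b x0 \<le> b y"
    by (metis (no_types, lifting) arg_min_if_finite(1) arg_min_least)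
  define C' where "C' = {y \<in> C. b y = b x0}"
  have "finite C'" "C' \<noteq> {}" using \<open>finite C\<close> x0 unfolding C'_def by auto
  then obtain x where x: "x \<in> C'" "\<And>y. y \<in> C' \<Longrightarrow> e x \<le> e y"
    by (metis (no_types, lifting) arg_min_if_finite(1) arg_min_least)
  have xC: "x \<in> U" "x \<notin> Sum ` Pow A" using x(1) unfolding C'_def C_def by auto
  have minb: "b x \<le> b y" if "y \<in> U" "y \<notin> Sum ` Pow A" for y
    using x(1) x0(2)[of y] that unfolding C'_def C_def by auto
  \<comment> \<open>Minimality of \<open>e x\<close> holds only against competitors whose
    \<open>b\<close> is no larger than \<open>b x\<close>; \<open>ind\<close> and \<open>leb\<close>
    below place every \<open>x + \<Sum>S\<close> with \<open>S \<subseteq> A\<close> among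
    them.\<close>
  have mine: "e x \<le> e y" if "y \<in> U" "y \<notin> Sum ` Pow A" "b y \<le> b x" for y
    using x minb[OF that(1,2)] that unfolding C'_def C_def by auto
  have cancel: "p + q + q = p" for p q :: 'v
    using char2[of q] by (simp add: add.assoc)
  have xA: "x \<notin> A"
    using xC(2) by (metis Pow_iff bot.extremum empty_iff finite.emptyI image_eqI insert_subsetI add.right_neutral sum.empty sum.insert)
  have ind: "x + \<Sum>S \<notin> Sum ` Pow A" if S: "S \<subseteq> A" for S
  proof
    assume "x + \<Sum>S \<in> Sum ` Pow A"
    then obtain T where T: "T \<subseteq> A" "x + \<Sum>S = \<Sum>T" by auto
    have fin: "finite S" "finite T" using finA S T(1) finite_subset by auto
    have "x = \<Sum>T + \<Sum>S" using T(2) cancel[of x "\<Sum>S"] by simp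
    also have "\<dots> = \<Sum>((T - S) \<union> (S - T))"
      using sum_sym_diff[OF char2 fin(2,1)] .
    finally have "x = \<Sum>((T - S) \<union> (S - T))" .
    then show False using xC(2) S T(1) by blast
  qed
  have inU: "x + \<Sum>S \<in> U" if "S \<subseteq> A" for S
  proof -
    have "finite S" using finA that finite_subset by auto
    then show ?thesis using that
    proof (induction S)
      case empty then show ?case using xC by simp
    next
      case (insert s S)
      then show ?case using U(2)[of s "x + \<Sum>S"] A(1) by (simp add: ac_simps subset_iff)
    qed
  qed
  \<comment> \<open>By \<open>greedy\<close>, the earlier vectors have \<open>b\<close> at most
    \<open>b x\<close>, so translating \<open>x\<close> by their span cannot raise \<open>b\<close>
    above \<open>b x\<close>.\<close>
  have leb: "b (x + \<Sum>S) \<le> b x" if "S \<subseteq> A" for S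
  proof -
    have "finite S" using finA that finite_subset by auto
    moreover have "b s \<le> b x" if "s \<in> S" for s
      using greedy[OF xC] \<open>S \<subseteq> A\<close> that by auto
    ultimately have "b (\<Sum>S) \<le> b x"
      by (rule ultrametric_sum[of b, OF b(1) _ b(2)])
    then show ?thesis using b(1)[of x "\<Sum>S"] by simp
  qed
  show thesis
  proof
    show "x \<in> U" "x \<notin> A" by fact+
    show "b a \<le> b y" if "y \<in> U" "y \<notin> Sum ` Pow (insert x A)" "a \<in> insert x A" for y a
    proof -
      have "y \<notin> Sum ` Pow A" using that(2) by auto
      then show ?thesis using that minb greedy by auto
    qed
  next
    fix S s assume S: "S \<subseteq> insert x A" "s \<in> S"
    show "\<Sum>S \<noteq> 0 \<and> b s \<le> b (\<Sum>S) \<and> e s \<le> e (\<Sum>S)"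
    proof (cases "x \<in> S")
      case False
      then show ?thesis using A(2)[of S s] S by blast
    next
      case True
      define S0 where "S0 = S - {x}"
      have S0: "S0 \<subseteq> A" "finite S0" "S = insert x S0" "x \<notin> S0"
        using True S finA finite_subset unfolding S0_def by auto
      have sumS: "\<Sum>S = x + \<Sum>S0" using S0 by simp
      have nz: "\<Sum>S \<noteq> 0"
        using ind[OF S0(1)] sumS by (metis Pow_bottom image_eqI sum.empty)
      have bx: "b x \<le> b (\<Sum>S)" using minb[OF inU[OF S0(1)] ind[OF S0(1)]] sumS by simp
      have bs: "b s \<le> b (\<Sum>S)"
        using greedy[OF xC, of s] bx S(2) S0 by auto
      \<comment> \<open>Otherwise the maximum \<open>m\<close> of \<open>e\<close> on
        \<open>S\<close> exceeds \<open>e (\<Sum>S)\<close>, so the terms of top value must cancel.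
        If \<open>x\<close> is one of them, the sum of the top terms is a translate of
        \<open>x\<close> of smaller \<open>e\<close>, against the choice of \<open>x\<close>. If
        not, the cancellation already happens inside \<open>A\<close>, against the assumption on
        \<open>A\<close>.\<close>
      have es: "e s \<le> e (\<Sum>S)"
      proof (rule ccontr)
        assume contra: "\<not> e s \<le> e (\<Sum>S)"
        define m where "m = Max (e ` S)"
        have finS: "finite S" using S0 by simp
        have mS: "e t \<le> m" if "t \<in> S" for t
          using that finS unfolding m_def by simp
        have m_in: "m \<in> e ` S" using S(2) finS unfolding m_def by (intro Max_in) auto
        have lt: "e (\<Sum>S) < m" using contra mS[OF S(2)] by simp
        show False
        proof (cases "e x = m")
          case True
          define T R where "T = {a \<in> S0. e a = m}" and "R = {a \<in> S0. e a < m}"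
          have TR: "S0 = T \<union> R" "T \<inter> R = {}" "finite T" "finite R" "T \<subseteq> A"
            using S0 mS unfolding T_def R_def by (auto simp: order.order_iff_strict)
          have "\<Sum>S = x + \<Sum>T + \<Sum>R"
            using sumS TR sum.union_disjoint[of T R id] by (simp add: ac_simps)
          then have eq: "x + \<Sum>T = \<Sum>S + \<Sum>R" using cancel by simp
          have "e (\<Sum>R) < m"
          \<comment> \<open>\<open>Max\<close> says nothing about the empty set, so an empty
            \<open>R\<close> is settled by \<open>e 0\<close> being least.\<close>
          proof (cases "R = {}")
            case True
            then show ?thesis using e(2)[of "\<Sum>S"] lt by simp
          next
            case False
            have "e (\<Sum>R) \<le> Max (e ` R)"
              using TR(4) by (rule ultrametric_sum[of e, OF e(1)])
                  (use TR(4) False in \<open>auto simp: Max_ge_iff intro: e(2)\<close>)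
            also have "\<dots> < m" using TR False unfolding R_def by (subst Max_less_iff) auto
            finally show ?thesis .
          qed
          then have "e (x + \<Sum>T) < e x"
            using eq e(1)[of "\<Sum>S" "\<Sum>R"] lt True by (simp add: le_max_iff_disj) (meson le_less_trans)
          moreover have "e x \<le> e (x + \<Sum>T)"
            using TR(5) by (intro mine inU ind leb)
          ultimately show False by simp
        next
          case False
          then obtain a where a: "a \<in> S0" "e a = m" using m_in S0 by auto
          have "e x < m" using False mS[OF True] by simp
          have "m \<le> e (\<Sum>S0)" using A(2)[OF S0(1) a(1)] a(2) by simp
          moreover have "\<Sum>S0 = \<Sum>S + x" using sumS cancel[of "\<Sum>S0" x] by (simp add: ac_simps)
          moreover have "e (\<Sum>S + x) < m"
            using order.strict_trans1[OF e(1)] lt \<open>e x < m\<close> by simp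
          ultimately show False by simp
        qed
      qed
      show ?thesis using nz bs es by simp
    qed
  qed
qed

text \<open>Two flags of a finite vector space over Z/2 have a common adapted basis. No nonempty
  subset of \<open>A\<close> sums to 0, which is independence; and by the ultrametric inequality
  \<open>b\<close> and \<open>e\<close> of a nonempty sum are the maxima over its terms, so each
  sublevel set in \<open>U\<close> is spanned by the members of \<open>A\<close> it
  contains.\<close>

lemma adapted_basis:
  fixes b e :: "'v::ab_group_add \<Rightarrow> 'l::linorder"
  assumes char2: "\<And>x :: 'v. x + x = 0"
    and U: "finite U" "\<And>x y. x \<in> U \<Longrightarrow> y \<in> U \<Longrightarrow> x + y \<in> U"
    and b: "\<And>x y. b (x + y) \<le> max (b x) (b y)" "\<And>x. b 0 \<le> b x"
    and e: "\<And>x y. e (x + y) \<le> max (e x) (e y)" "\<And>x. e 0 \<le> e x"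
  obtains A where "A \<subseteq> U" "U \<subseteq> Sum ` Pow A"
    "\<And>S s. S \<subseteq> A \<Longrightarrow> s \<in> S \<Longrightarrow> \<Sum>S \<noteq> 0 \<and> b s \<le> b (\<Sum>S) \<and> e s \<le> e (\<Sum>S)"
proof -
  \<comment> \<open>The last clause records the greedy order: no vector outside the current span has
    smaller \<open>b\<close> than a chosen one. It is the invariant that the extension step consumes
    and restores.\<close>
  define good where "good A \<longleftrightarrow> A \<subseteq> U \<and>
    (\<forall>S s. S \<subseteq> A \<longrightarrow> s \<in> S \<longrightarrow> \<Sum>S \<noteq> 0 \<and> b s \<le> b (\<Sum>S) \<and> e s \<le> e (\<Sum>S)) \<and>
    (\<forall>y a. y \<in> U \<longrightarrow> y \<notin> Sum ` Pow A \<longrightarrow> a \<in> A \<longrightarrow> b a \<le> b y)" for A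
  have ext: "\<exists>A'. good A' \<and> A \<subset> A'" if A: "good A" and y: "y \<in> U" "y \<notin> Sum ` Pow A" for A y
  proof -
    obtain x where x: "x \<in> U" "x \<notin> A"
      "\<And>S s. S \<subseteq> insert x A \<Longrightarrow> s \<in> S \<Longrightarrow> \<Sum>S \<noteq> 0 \<and> b s \<le> b (\<Sum>S) \<and> e s \<le> e (\<Sum>S)"
      "\<And>y a. y \<in> U \<Longrightarrow> y \<notin> Sum ` Pow (insert x A) \<Longrightarrow> a \<in> insert x A \<Longrightarrow> b a \<le> b y"
    proof (rule adapted_basis_extend[where A = A and b = b and e = e and U = U and y = y])
    qed (use assms A y in \<open>auto simp: good_def\<close>)
    have "insert x A \<subseteq> U" using x(1) A unfolding good_def by simp
    then have "good (insert x A)"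
      unfolding good_def using x(3,4) by (intro conjI allI impI) simp_all
    then show ?thesis using x(2) by blast
  qed
  have "finite {A. good A}"
    by (rule finite_subset[of _ "Pow U"]) (use U(1) in \<open>auto simp: good_def\<close>)
  moreover have "{} \<in> {A. good A}" by (auto simp: good_def)
  ultimately have "\<exists>A\<in>{A. good A}. {} \<subseteq> A \<and> (\<forall>A'\<in>{A. good A}. A \<subseteq> A' \<longrightarrow> A = A')"
    by (rule finite_has_maximal2)
  then obtain A where A: "good A" "\<And>A'. good A' \<Longrightarrow> A \<subseteq> A' \<Longrightarrow> A = A'"
    by auto
  have "U \<subseteq> Sum ` Pow A"
  proof
    fix y assume "y \<in> U"
    show "y \<in> Sum ` Pow A"
    proof (rule ccontr)
      assume "y \<notin> Sum ` Pow A"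
      then obtain A' where "good A'" "A \<subset> A'" using ext[OF A(1) \<open>y \<in> U\<close>] by auto
      then show False using A(2)[of A'] by auto
    qed
  qed
  with A(1) show thesis unfolding good_def by (intro that[of A]) auto
qed

section \<open>Existence of interval decompositions\<close>

text \<open>Encodes a filtration as a function with the filtration as its sublevel sets. The value
  is \<open>\<infinity>\<close> on elements that never enter and \<open>-\<infinity>\<close> on
  those present at all times.\<close>

definition entry_time :: "(real \<Rightarrow> 'b set) \<Rightarrow> 'b \<Rightarrow> ereal" where
  "entry_time F x = Inf {ereal t | t. x \<in> F t}"

text \<open>By \<open>rcont\<close> and monotonicity the filtration is constant for a while after
  each \<open>t\<close>, so an element entering at all times just after \<open>t\<close> is present
  at \<open>t\<close>: a real infimum is attained.\<close>

lemma entry_time_le_iff: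
  assumes mono: "\<And>s t. s \<le> t \<Longrightarrow> F s \<subseteq> F t" and rcont: "\<And>t. \<exists>s>t. F s = F t"
  shows "entry_time F x \<le> ereal t \<longleftrightarrow> x \<in> F t"
proof
  show "entry_time F x \<le> ereal t" if "x \<in> F t"
    using that unfolding entry_time_def by (auto intro: Inf_lower)
  assume le: "entry_time F x \<le> ereal t"
  obtain s where s: "t < s" "F s = F t" using rcont by blast
  have "Inf {ereal t | t. x \<in> F t} < ereal s"
    using le s(1) unfolding entry_time_def by (simp add: order.strict_trans1)
  then obtain t' where "x \<in> F t'" "t' < s"
    unfolding Inf_less_iff by auto
  then show "x \<in> F t" using mono[of t' s] s(2) by auto
qed

lemma entry_time_add:
  assumes "\<And>s t. s \<le> t \<Longrightarrow> F s \<subseteq> F t" "\<And>t. \<exists>s>t. F s = F t"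
    and "\<And>t x y. x \<in> F t \<Longrightarrow> y \<in> F t \<Longrightarrow> x + y \<in> F t"
  shows "entry_time F (x + y) \<le> max (entry_time F x) (entry_time F y)"
proof (rule ereal_le_real)
  fix r assume "max (entry_time F x) (entry_time F y) \<le> ereal r"
  then show "entry_time F (x + y) \<le> ereal r"
    using assms(3)[of x r y] entry_time_le_iff[OF assms(1,2)] by simp
qed

section \<open>Persistence of a monotone family of finite complexes\<close>

locale finite_filtration =
  fixes V :: "'a set" and X :: "real \<Rightarrow> 'a set set"
  assumes finite_V: "finite V" and sub_Pow: "X t \<subseteq> Pow V" and mono_X: "s \<le> t \<Longrightarrow> X s \<subseteq> X t"
begin

lemmas cycles_plus = cycles_add[OF finite_V sub_Pow]
lemmas boundaries_plus = boundaries_add[OF finite_V sub_Pow]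

lemma cycles_sum: "(\<And>i. i \<in> S \<Longrightarrow> f i \<in> cycles k (X t)) \<Longrightarrow> sum f S \<in> cycles k (X t)"
  by (rule sum_mem_additive[OF cycles_zero cycles_plus])

lemma boundaries_sum:
  "(\<And>i. i \<in> S \<Longrightarrow> f i \<in> boundaries k (X t)) \<Longrightarrow> sum f S \<in> boundaries k (X t)"
  by (rule sum_mem_additive[OF boundaries_zero boundaries_plus])

text \<open>A basis of the chain space is adapted to the entry times \<open>vZ\<close> into the
  cycles and \<open>vB\<close> into the boundaries. Its members with \<open>vZ a < vB a\<close> are
  the bars, born at \<open>vZ a\<close> and dying at \<open>vB a\<close>; any other member is a
  boundary as soon as it is a cycle and contributes nothing.\<close>

lemma ex_interval_decomposition:
  assumes empty: "X t0 = {}" and rcont: "\<And>t. \<exists>s>t. X s = X t"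
  shows "\<exists>I b e z. interval_decomposition k X I b e z"
proof -
  define U where "U = chains k (Pow V)"
  define vZ where "vZ = entry_time (\<lambda>t. cycles k (X t))"
  define vB where "vB = entry_time (\<lambda>t. boundaries k (X t))"
  have rZ: "\<exists>s>t. cycles k (X s) = cycles k (X t)"
    and rB: "\<exists>s>t. boundaries k (X s) = boundaries k (X t)" for t
    using rcont[of t] by metis+
  have Z: "vZ x \<le> ereal t \<longleftrightarrow> x \<in> cycles k (X t)" for x t
    unfolding vZ_def using cycles_mono[OF mono_X] rZ by (rule entry_time_le_iff)
  have B: "vB x \<le> ereal t \<longleftrightarrow> x \<in> boundaries k (X t)" for x t
    unfolding vB_def using boundaries_mono[OF mono_X] rB by (rule entry_time_le_iff)
  have least: "vZ 0 \<le> vZ x" "vB 0 \<le> vB x" for x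
    by (rule ereal_le_real; simp add: Z B cycles_zero boundaries_zero)+
  obtain A where A: "A \<subseteq> U" "U \<subseteq> Sum ` Pow A"
    "\<And>S s. S \<subseteq> A \<Longrightarrow> s \<in> S \<Longrightarrow> \<Sum>S \<noteq> 0 \<and> vZ s \<le> vZ (\<Sum>S) \<and> vB s \<le> vB (\<Sum>S)"
  proof (rule adapted_basis[of U vZ vB])
    show "finite U" unfolding U_def by (rule finite_chains[OF finite_V])
    show "x + y \<in> U" if "x \<in> U" "y \<in> U" for x y
      using that unfolding U_def by (rule chains_add)
    show "vZ (x + y) \<le> max (vZ x) (vZ y)" for x y
      unfolding vZ_def using cycles_mono[OF mono_X] rZ cycles_plus by (rule entry_time_add)
    show "vB (x + y) \<le> max (vB x) (vB y)" for x y
      unfolding vB_def using boundaries_mono[OF mono_X] rB boundaries_plus by (rule entry_time_add)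
  qed (use least in auto)
  have finA: "finite A" using A(1) finite_chains[OF finite_V] finite_subset unfolding U_def by auto
  define A0 where "A0 = {a \<in> A. vZ a < vB a}"
  define I where "I = {0..<card A0}"
  have "finite A0" using finA unfolding A0_def by simp
  then obtain h where h: "bij_betw h I A0" unfolding I_def using ex_bij_betw_nat_finite by blast
  have injh: "inj_on h I" and hI: "h ` I = A0" using h by (auto simp: bij_betw_def)
  \<comment> \<open>A basis vector is nonzero, while at \<open>t0\<close> the complex is empty and
    has only the zero cycle. This excludes birth \<open>-\<infinity>\<close>; birth
    \<open>\<infinity>\<close> is excluded by \<open>vZ a < vB a\<close>.\<close>
  have real_birth: "ereal (real_of_ereal (vZ a)) = vZ a" if a: "a \<in> A0" for a
  proof -
    have "a \<noteq> 0" using A(3)[of "{a}" a] a unfolding A0_def by auto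
    moreover have "cycles k (X t0) \<subseteq> {0}" unfolding empty cycles_def chains_def by (auto intro: ext)
    ultimately have "\<not> vZ a \<le> ereal t0" using Z by auto
    moreover have "vZ a \<noteq> \<infinity>" using a unfolding A0_def by auto
    ultimately show ?thesis by (cases "vZ a") auto
  qed
  define b e where "b i = real_of_ereal (vZ (h i))" and "e i = vB (h i)" for i
  have b: "ereal (b i) = vZ (h i)" if "i \<in> I" for i
    using that real_birth hI unfolding b_def by auto
  have hA: "h i \<in> A" if "i \<in> I" for i using that hI unfolding A0_def by auto
  have "interval_decomposition k X I b e h"
    unfolding interval_decomposition_def
  proof (intro conjI ballI allI impI)
    show "finite I" unfolding I_def by simp
    show "ereal (b i) < e i" if "i \<in> I" for i
      using that hI b[OF that] unfolding e_def A0_def by auto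
    show "h i \<in> cycles k (X (b i))" if "i \<in> I" for i
      using b[OF that] Z[of "h i" "b i"] by simp
    show "h i \<in> boundaries k (X t)" if "i \<in> I" "e i \<le> ereal t" for i t
      using that B unfolding e_def by simp
  next
    fix t c assume c: "c \<in> cycles k (X t)"
    let ?P = "\<lambda>S. S \<subseteq> {i \<in> I. b i \<le> t \<and> ereal t < e i} \<and> c - sum h S \<in> boundaries k (X t)"
    have "c \<in> U" using c chains_mono[OF sub_Pow] unfolding cycles_def U_def by auto
    then obtain T where T: "T \<subseteq> A" "c = \<Sum>T" using A(2) by auto
    have finT: "finite T" using T(1) finA finite_subset by auto
    \<comment> \<open>Only the basis vectors not yet boundaries at \<open>t\<close> are kept; the
      others change \<open>c\<close> by a boundary.\<close>
    define T' where "T' = {s \<in> T. ereal t < vB s}"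
    \<comment> \<open>Adaptedness to \<open>vZ\<close>: a cycle at time \<open>t\<close> expands
      into basis vectors that are themselves cycles at \<open>t\<close>.\<close>
    have vT: "vZ s \<le> ereal t" if "s \<in> T" for s
      using A(3)[OF T(1) that] T(2) Z[of c t] c by (meson order.trans)
    have T'0: "T' \<subseteq> A0" using vT T(1) unfolding T'_def A0_def by (auto intro: order.strict_trans1)
    define S where "S = {i \<in> I. h i \<in> T'}"
    have hS: "h ` S = T'" using T'0 hI unfolding S_def by auto
    have "inj_on h S" using injh by (rule inj_on_subset) (auto simp: S_def)
    then have sumS: "sum h S = \<Sum>T'" using sum.reindex[of h S id] hS by simp
    have "\<Sum>(T - T') \<in> boundaries k (X t)"
      using B by (intro boundaries_sum) (auto simp: T'_def not_less)
    moreover have "c = \<Sum>T' + \<Sum>(T - T')"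
      using T(2) sum.subset_diff[of T' T id] finT by (auto simp: T'_def add.commute)
    ultimately have "c - sum h S \<in> boundaries k (X t)" using sumS by simp
    moreover have "S \<subseteq> {i \<in> I. b i \<le> t \<and> ereal t < e i}"
    proof
      fix i assume "i \<in> S"
      then have i: "i \<in> I" "h i \<in> T" "ereal t < vB (h i)" unfolding S_def T'_def by auto
      then show "i \<in> {i \<in> I. b i \<le> t \<and> ereal t < e i}"
        using vT[OF i(2)] b[OF i(1)] unfolding e_def by (metis (mono_tags, lifting) ereal_less_eq(3) mem_Collect_eq)
    qed
    ultimately have "?P S" by simp
    moreover have "S1 = S2" if S1: "?P S1" and S2: "?P S2" for S1 S2
    proof -
      have sub: "S1 \<subseteq> I" "S2 \<subseteq> I" using S1 S2 by auto
      have fin: "finite S1" "finite S2" using sub unfolding I_def by (auto intro: finite_subset)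
      \<comment> \<open>The symmetric difference of two solutions sums to a boundary at
        \<open>t\<close>. Adaptedness to \<open>vB\<close> then makes each of its members a boundary
        at \<open>t\<close>, yet all of them are alive there, so \<open>D\<close> is empty.\<close>
      define D where "D = (S1 - S2) \<union> (S2 - S1)"
      have "(c + c) + sum h D = (c + sum h S1) + (c + sum h S2)"
        unfolding D_def sum_sym_diff[OF bit_fun_add_self fin, symmetric] by (simp only: ac_simps)
      then have "sum h D = (c - sum h S1) + (c - sum h S2)" by (simp add: bit_fun_diff)
      also have "\<dots> \<in> boundaries k (X t)" using S1 S2 by (intro boundaries_plus) auto
      finally have mem: "sum h D \<in> boundaries k (X t)" .
      have "D \<subseteq> I" using sub unfolding D_def by auto
      then have "inj_on h D" using injh inj_on_subset by blast
      then have "sum h D = \<Sum>(h ` D)" using sum.reindex[of h D id] by simp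
      then have le: "vB (\<Sum>(h ` D)) \<le> ereal t" using mem B by simp
      have hD: "h ` D \<subseteq> A" using \<open>D \<subseteq> I\<close> hA by auto
      have "D = {}"
      proof (rule equals0I)
        fix i assume i: "i \<in> D"
        then have "vB (h i) \<le> ereal t" using A(3)[OF hD, of "h i"] le by (auto intro: order.trans)
        moreover have "ereal t < vB (h i)" using i S1 S2 unfolding D_def e_def by auto
        ultimately show False by simp
      qed
      then show ?thesis unfolding D_def by auto
    qed
    ultimately show "\<exists>!S. ?P S" by blast
  qed
  then show ?thesis by blast
qed

section \<open>Comparison of interval decompositions\<close>

text \<open>A class at time \<open>s\<close> is expanded in the bars alive at \<open>s\<close> and
  pushed forward to \<open>t\<close>, where the bars that have died in between become boundaries.
  What survives was born by \<open>s\<close> and is alive at \<open>t\<close>.\<close>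

lemma cycle_reduce:
  assumes dec: "interval_decomposition k X I b e z" and "s \<le> t" and c: "c \<in> cycles k (X s)"
  obtains S where "S \<subseteq> {i \<in> I. b i \<le> s \<and> ereal t < e i}" "c + sum z S \<in> boundaries k (X t)"
proof -
  obtain S where S: "S \<subseteq> {i \<in> I. b i \<le> s \<and> ereal s < e i}" "c - sum z S \<in> boundaries k (X s)"
    using dec[unfolded interval_decomposition_def, THEN conjunct2, THEN conjunct2, rule_format, OF c]
    by (elim ex1E conjE)
  have fin: "finite S" using S(1) dec finite_subset unfolding interval_decomposition_def by fastforce
  define S' where "S' = {i \<in> S. ereal t < e i}"
  have "sum z (S - S') \<in> boundaries k (X t)"
    using dec S(1) by (intro boundaries_sum) (auto simp: S'_def interval_decomposition_def not_less)
  moreover have "c + sum z S \<in> boundaries k (X t)"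
    using S(2) boundaries_mono[OF mono_X[OF \<open>s \<le> t\<close>]] by (auto simp: bit_fun_diff)
  ultimately have "(c + sum z S) + sum z (S - S') \<in> boundaries k (X t)"
    by (rule boundaries_plus[rotated])
  moreover have "sum z S = sum z S' + sum z (S - S')"
    using sum.subset_diff[of S' S z] fin by (auto simp: S'_def add.commute)
  ultimately have "c + sum z S' \<in> boundaries k (X t)" by (simp add: add.assoc)
  moreover have "S' \<subseteq> {i \<in> I. b i \<le> s \<and> ereal t < e i}" using S(1) unfolding S'_def by auto
  ultimately show thesis using that by blast
qed

text \<open>The cycle \<open>sum z S\<close> is represented by \<open>S\<close> itself, and by
  assumption also by \<open>T\<close>; representations by alive bars are unique.\<close>

lemma alive_independent:
  assumes dec: "interval_decomposition k X I b e z"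
    and S: "S \<subseteq> {i \<in> I. b i \<le> t \<and> ereal t < e i}" and T: "T \<subseteq> {i \<in> I. b i \<le> t \<and> ereal t < e i}"
    and "sum z S + sum z T \<in> boundaries k (X t)"
  shows "S = T"
proof -
  have "sum z S \<in> cycles k (X t)"
  proof (rule cycles_sum)
    fix i assume "i \<in> S"
    then have "z i \<in> cycles k (X (b i))" "b i \<le> t"
      using dec S unfolding interval_decomposition_def by auto
    then show "z i \<in> cycles k (X t)" using cycles_mono[OF mono_X] by blast
  qed
  then have "\<exists>!R. R \<subseteq> {i \<in> I. b i \<le> t \<and> ereal t < e i} \<and> sum z S - sum z R \<in> boundaries k (X t)"
    by (rule dec[unfolded interval_decomposition_def, THEN conjunct2, THEN conjunct2, rule_format])
  then have "\<exists>\<^sub>\<le>\<^sub>1R. R \<subseteq> {i \<in> I. b i \<le> t \<and> ereal t < e i} \<and> sum z S - sum z R \<in> boundaries k (X t)"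
    by (simp only: ex1_iff_ex_Uniq)
  then show ?thesis
    by (rule Uniq_D) (use S T assms(4) boundaries_zero in \<open>simp_all add: bit_fun_diff\<close>)
qed

end

text \<open>The bars born at \<open>\<beta>\<close> and alive at \<open>t\<close> are counted by the image of \<open>H\<^sub>k(X \<beta>)\<close> in \<open>H\<^sub>k(X t)\<close>
  modulo the image of \<open>H\<^sub>k(X \<beta>')\<close> for \<open>\<beta>' < \<beta>\<close> close to \<open>\<beta>\<close>; this quotient inherits the
  surjectivity of \<open>H\<^sub>k(X) \<rightarrow> H\<^sub>k(Y)\<close>.\<close>

lemma bars_card_le:
  assumes "finite_filtration V X" "finite_filtration V Y" and sub: "\<And>t. X t \<subseteq> Y t"
    and surj: "\<And>t c. c \<in> cycles k (Y t) \<Longrightarrow> \<exists>c'\<in>cycles k (X t). c + c' \<in> boundaries k (Y t)"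
    and decX: "interval_decomposition k X I b e z" and decY: "interval_decomposition k Y J b' e' z'"
    and "\<beta> \<le> t"
  shows "card {j \<in> J. b' j = \<beta> \<and> ereal t < e' j} \<le> card {i \<in> I. b i = \<beta> \<and> ereal t < e i}"
proof -
  interpret X: finite_filtration V X by fact
  interpret Y: finite_filtration V Y by fact
  define K L where "K = {j \<in> J. b' j = \<beta> \<and> ereal t < e' j}"
    and "L = {i \<in> I. b i = \<beta> \<and> ereal t < e i}"
  have finI: "finite I" and finJ: "finite J"
    using decX decY unfolding interval_decomposition_def by auto
  \<comment> \<open>Each combination of bars of \<open>Y\<close> born at \<open>\<beta>\<close> is
    lifted to \<open>X\<close> at time \<open>\<beta>\<close> by surjectivity and then expressed at
    \<open>t\<close> through bars of \<open>X\<close> born by \<open>\<beta>\<close>.\<close>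
  have "\<forall>T\<in>Pow K. \<exists>S. S \<subseteq> {i \<in> I. b i \<le> \<beta> \<and> ereal t < e i} \<and>
      sum z' T + sum z S \<in> boundaries k (Y t)"
  proof
    fix T assume T: "T \<in> Pow K"
    have "sum z' T \<in> cycles k (Y \<beta>)"
      using decY T by (intro Y.cycles_sum) (auto simp: K_def interval_decomposition_def)
    then obtain m where m: "m \<in> cycles k (X \<beta>)" "sum z' T + m \<in> boundaries k (Y \<beta>)"
      using surj by blast
    obtain S where S: "S \<subseteq> {i \<in> I. b i \<le> \<beta> \<and> ereal t < e i}" "m + sum z S \<in> boundaries k (X t)"
      using X.cycle_reduce[OF decX \<open>\<beta> \<le> t\<close> m(1)] .
    have "sum z' T + m \<in> boundaries k (Y t)" "m + sum z S \<in> boundaries k (Y t)"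
      using m(2) S(2) boundaries_mono[OF sub] boundaries_mono[OF Y.mono_X[OF \<open>\<beta> \<le> t\<close>]] by blast+
    then have "(sum z' T + m) + (m + sum z S) \<in> boundaries k (Y t)" by (rule Y.boundaries_plus)
    moreover have "(sum z' T + m) + (m + sum z S) = sum z' T + (m + m) + sum z S"
      by (simp only: add.assoc)
    ultimately show "\<exists>S. S \<subseteq> {i \<in> I. b i \<le> \<beta> \<and> ereal t < e i} \<and>
        sum z' T + sum z S \<in> boundaries k (Y t)"
      using S(1) by auto
  qed
  from bchoice[OF this] obtain f where f0: "\<forall>T\<in>Pow K. f T \<subseteq> {i \<in> I. b i \<le> \<beta> \<and> ereal t < e i} \<and>
      sum z' T + sum z (f T) \<in> boundaries k (Y t)" ..
  then have f: "\<And>T. T \<in> Pow K \<Longrightarrow> f T \<subseteq> {i \<in> I. b i \<le> \<beta> \<and> ereal t < e i}"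
    "\<And>T. T \<in> Pow K \<Longrightarrow> sum z' T + sum z (f T) \<in> boundaries k (Y t)"
    by simp_all
  \<comment> \<open>Intersecting with \<open>L\<close> forgets the bars born before
    \<open>\<beta>\<close>. Two combinations with the same remaining part differ in
    \<open>Y t\<close> by something born earlier, which cannot involve bars of
    \<open>K\<close>.\<close>
  have "inj_on (\<lambda>T. f T \<inter> L) (Pow K)"
  proof (rule inj_onI)
    fix T T' assume TT: "T \<in> Pow K" "T' \<in> Pow K" and eq: "f T \<inter> L = f T' \<inter> L"
    define R where "R = ((f T - f T') \<union> (f T' - f T))"
    have finf: "finite (f T)" "finite (f T')"
      using f(1) TT finI by (auto intro: finite_subset[of _ I])
    have finR: "finite R" using finf unfolding R_def by auto
    have "R \<inter> L = {}" using eq unfolding R_def by auto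
    have Rlt: "i \<in> I" "b i < \<beta>" if "i \<in> R" for i
    proof -
      have "i \<in> {i \<in> I. b i \<le> \<beta> \<and> ereal t < e i}"
        using that f(1)[of T] f(1)[of T'] TT unfolding R_def by blast
      moreover have "i \<notin> L" using that \<open>R \<inter> L = {}\<close> by blast
      ultimately show "i \<in> I" "b i < \<beta>" unfolding L_def by auto
    qed
    \<comment> \<open>The latest birth in \<open>R\<close>; the extra value
      \<open>\<beta> - 1\<close> keeps \<open>\<beta>'\<close> defined and below
      \<open>\<beta>\<close> when \<open>R\<close> is empty.\<close>
    define \<beta>' where "\<beta>' = Max (insert (\<beta> - 1) (b ` R))"
    have \<beta>'lt: "\<beta>' < \<beta>" using finR Rlt unfolding \<beta>'_def by simp
    have \<beta>'ge: "b i \<le> \<beta>'" if "i \<in> R" for i using finR that unfolding \<beta>'_def by (intro Max_ge) auto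
    have zR: "sum z R \<in> cycles k (Y \<beta>')"
    proof (rule Y.cycles_sum)
      fix i assume "i \<in> R"
      then have "z i \<in> cycles k (X (b i))"
        using Rlt decX unfolding interval_decomposition_def by blast
      then show "z i \<in> cycles k (Y \<beta>')"
        using cycles_mono[OF sub] cycles_mono[OF Y.mono_X[OF \<beta>'ge[OF \<open>i \<in> R\<close>]]] by blast
    qed
    have "\<beta>' \<le> t" using \<beta>'lt \<open>\<beta> \<le> t\<close> by simp
    \<comment> \<open>The difference lives in \<open>Y\<close> already at \<open>\<beta>'\<close>,
      hence reduces to bars of \<open>Y\<close> born strictly before \<open>\<beta>\<close>, which
      are disjoint from \<open>K\<close>.\<close>
    obtain S where S: "S \<subseteq> {j \<in> J. b' j \<le> \<beta>' \<and> ereal t < e' j}"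
      "sum z R + sum z' S \<in> boundaries k (Y t)"
      using Y.cycle_reduce[OF decY \<open>\<beta>' \<le> t\<close> zR] .
    have "sum z R = sum z (f T) + sum z (f T')"
      unfolding R_def by (rule sum_sym_diff[OF bit_fun_add_self finf, symmetric])
    moreover have "(sum z' T + sum z (f T)) + ((sum z' T' + sum z (f T')) + (sum z R + sum z' S))
        \<in> boundaries k (Y t)"
      by (rule Y.boundaries_plus[OF f(2)[OF TT(1)] Y.boundaries_plus[OF f(2)[OF TT(2)] S(2)]])
    moreover have "(p + q) + ((p' + q') + ((q + q') + r)) = p + (p' + r)"
      for p q p' q' r :: "'a set \<Rightarrow> bit"
    proof -
      have "(p + q) + ((p' + q') + ((q + q') + r)) = p + (p' + r) + (q + q) + (q' + q')"
        by (simp only: ac_simps)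
      then show ?thesis by simp
    qed
    moreover have "sum z' T' + sum z' S = sum z' (T' \<union> S)"
    proof (rule sum.union_disjoint[symmetric])
      show "finite T'" "finite S" using TT S(1) finJ by (auto simp: K_def intro: finite_subset[of _ J])
      show "T' \<inter> S = {}" using TT S(1) \<beta>'lt unfolding K_def by fastforce
    qed
    ultimately have "sum z' T + sum z' (T' \<union> S) \<in> boundaries k (Y t)" by (simp only:)
    then have "T = T' \<union> S"
      using TT S(1) \<beta>'lt \<open>\<beta> \<le> t\<close>
      by (intro Y.alive_independent[OF decY]) (auto simp: K_def)
    then show "T = T'" using TT S(1) \<beta>'lt unfolding K_def by fastforce
  qed
  moreover have "(\<lambda>T. f T \<inter> L) ` Pow K \<subseteq> Pow L" by auto
  moreover have "finite (Pow L)" using finI unfolding L_def by simp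
  \<comment> \<open>Comparing numbers of subsets compares the exponents of 2, that is, the
    dimensions.\<close>
  ultimately have "card (Pow K) \<le> card (Pow L)" by (metis card_inj_on_le)
  then have "card K \<le> card L" using finI finJ by (simp add: card_Pow K_def L_def)
  then show ?thesis unfolding K_def L_def .
qed

section \<open>From bar counts to injections\<close>

text \<open>Hall's condition for nested sets of admissible partners. An element \<open>c0\<close>
  with least \<open>f\<close> is matched last: all partners used so far also dominate
  \<open>f c0\<close>, and the count at \<open>c0\<close> leaves at least one of them free.\<close>

lemma ex_dominating_injection:
  fixes f :: "'c \<Rightarrow> 'l::linorder"
  assumes "finite C" "finite D"
    and "\<And>c. c \<in> C \<Longrightarrow> card {x \<in> C. f c \<le> f x} \<le> card {d \<in> D. f c \<le> g d}"
  shows "\<exists>\<phi>. inj_on \<phi> C \<and> \<phi> ` C \<subseteq> D \<and> (\<forall>c\<in>C. f c \<le> g (\<phi> c))"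
  using assms(1,3)
proof (induction C rule: finite_psubset_induct)
  case (psubset C)
  show ?case
  proof (cases "C = {}")
    case False
    then obtain c0 where c0: "c0 \<in> C" "\<And>c. c \<in> C \<Longrightarrow> f c0 \<le> f c"
      using arg_min_if_finite(1)[OF psubset.hyps(1)] arg_min_least[OF psubset.hyps(1)] by metis
    define C' where "C' = C - {c0}"
    have C': "C' \<subset> C" "C = insert c0 C'" "c0 \<notin> C'" "finite C'"
      using c0(1) psubset.hyps(1) unfolding C'_def by auto
    have "card {x \<in> C'. f c \<le> f x} \<le> card {d \<in> D. f c \<le> g d}" if "c \<in> C'" for c
    proof -
      have "card {x \<in> C'. f c \<le> f x} \<le> card {x \<in> C. f c \<le> f x}"
        using C' psubset.hyps(1) by (intro card_mono) auto
      also have "\<dots> \<le> card {d \<in> D. f c \<le> g d}" using psubset.prems that C'(1) by blast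
      finally show ?thesis .
    qed
    then obtain \<phi> where \<phi>: "inj_on \<phi> C'" "\<phi> ` C' \<subseteq> D" "\<forall>c\<in>C'. f c \<le> g (\<phi> c)"
      using psubset.IH[OF C'(1)] by blast
    define D0 where "D0 = {d \<in> D. f c0 \<le> g d}"
    have "\<phi> ` C' \<subseteq> D0"
    proof (rule image_subsetI)
      fix c assume "c \<in> C'"
      then have "\<phi> c \<in> D" "f c0 \<le> f c" "f c \<le> g (\<phi> c)"
        using \<phi>(2,3) c0(2) C'(1) by auto
      then show "\<phi> c \<in> D0" unfolding D0_def by (simp add: order.trans[of "f c0" "f c"])
    qed
    moreover have "card (\<phi> ` C') < card D0"
    proof -
      have "card (\<phi> ` C') < card C"
        using card_image_le[OF C'(4), of \<phi>] C' by simp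
      also have "C = {x \<in> C. f c0 \<le> f x}" using c0(2) by auto
      also have "card \<dots> \<le> card D0" unfolding D0_def using psubset.prems[OF c0(1)] .
      finally show ?thesis .
    qed
    ultimately have "\<phi> ` C' \<subset> D0" by auto
    then obtain d where d: "d \<in> D" "f c0 \<le> g d" "d \<notin> \<phi> ` C'" unfolding D0_def by blast
    have "inj_on (\<phi>(c0 := d)) C"
      unfolding C'(2) using \<phi>(1) d(3) C'(3) by (auto simp: inj_on_def)
    moreover have "(\<phi>(c0 := d)) ` C \<subseteq> D" using \<phi>(2) d(1) C' by auto
    moreover have "\<forall>c\<in>C. f c \<le> g ((\<phi>(c0 := d)) c)" using \<phi>(3) d(2) C' by auto
    ultimately show ?thesis by blast
  qed simp
qed

text \<open>Turns counts of bars alive at a real time into counts by a lower bound on the death,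
  which may be infinite.\<close>

lemma card_death_ge_le:
  fixes e :: "'i \<Rightarrow> ereal" and e' :: "'j \<Rightarrow> ereal"
  assumes fin: "finite I" "finite J"
    and card: "\<And>t. \<beta> \<le> t \<Longrightarrow>
      card {j \<in> J. b' j = \<beta> \<and> ereal t < e' j} \<le> card {i \<in> I. b i = \<beta> \<and> ereal t < e i}"
    and x: "ereal \<beta> < x"
  shows "card {j \<in> J. b' j = \<beta> \<and> x \<le> e' j} \<le> card {i \<in> I. b i = \<beta> \<and> x \<le> e i}"
proof -
  \<comment> \<open>No bar of \<open>I\<close> dies strictly between \<open>m\<close> and
    \<open>x\<close>, so in \<open>I\<close> outliving \<open>m\<close> means reaching
    \<open>x\<close>. Including \<open>\<beta>\<close> makes \<open>m\<close> real and at least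
    \<open>\<beta>\<close>, as the count hypothesis requires.\<close>
  define m where "m = Max (insert (ereal \<beta>) {y \<in> e ` I. y < x})"
  have fm: "finite (insert (ereal \<beta>) {y \<in> e ` I. y < x})" using fin by simp
  have "m < x" "ereal \<beta> \<le> m" unfolding m_def using fm x by auto
  then obtain t where t: "m = ereal t" "\<beta> \<le> t" by (cases m) auto
  have ge: "e i \<le> ereal t" if "i \<in> I" "e i < x" for i
    unfolding t(1)[symmetric] m_def using fm that by (intro Max_ge) auto
  have "card {j \<in> J. b' j = \<beta> \<and> x \<le> e' j} \<le> card {j \<in> J. b' j = \<beta> \<and> ereal t < e' j}"
    using fin \<open>m < x\<close> t(1) by (intro card_mono) (auto intro: order.strict_trans2)
  also have "\<dots> \<le> card {i \<in> I. b i = \<beta> \<and> ereal t < e i}" by (rule card[OF t(2)])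
  also have "\<dots> \<le> card {i \<in> I. b i = \<beta> \<and> x \<le> e i}"
    using fin ge by (intro card_mono) (auto simp: not_le[symmetric])
  finally show ?thesis .
qed

text \<open>Bars are matched separately for each birth value. The matchings glue to an injection
  because each preserves births.\<close>

lemma ex_bar_injection:
  fixes b :: "'i \<Rightarrow> real" and e :: "'i \<Rightarrow> ereal" and b' :: "'j \<Rightarrow> real" and e' :: "'j \<Rightarrow> ereal"
  assumes fin: "finite I" "finite J"
    and card: "\<And>\<beta> t. \<beta> \<le> t \<Longrightarrow>
      card {j \<in> J. b' j = \<beta> \<and> ereal t < e' j} \<le> card {i \<in> I. b i = \<beta> \<and> ereal t < e i}"
    and pos: "\<And>j. j \<in> J \<Longrightarrow> ereal (b' j) < e' j"
  shows "\<exists>\<psi>. inj_on \<psi> J \<and> \<psi> ` J \<subseteq> I \<and> (\<forall>j\<in>J. b (\<psi> j) = b' j \<and> e' j \<le> e (\<psi> j))"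
proof -
  have "\<forall>\<beta>. \<exists>\<phi>. inj_on \<phi> {j \<in> J. b' j = \<beta>} \<and> \<phi> ` {j \<in> J. b' j = \<beta>} \<subseteq> {i \<in> I. b i = \<beta>} \<and>
      (\<forall>j\<in>{j \<in> J. b' j = \<beta>}. e' j \<le> e (\<phi> j))"
  proof (rule allI, rule ex_dominating_injection)
    fix \<beta> c assume c: "c \<in> {j \<in> J. b' j = \<beta>}"
    then have "ereal \<beta> < e' c" using pos by auto
    from card_death_ge_le[of I J \<beta> b' e' b e, OF fin card this]
    show "card {x \<in> {j \<in> J. b' j = \<beta>}. e' c \<le> e' x} \<le> card {d \<in> {i \<in> I. b i = \<beta>}. e' c \<le> e d}"
      by (simp add: conj_assoc)
  qed (use fin in auto)
  from choice[OF this] obtain \<Phi> where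
    "\<forall>\<beta>. inj_on (\<Phi> \<beta>) {j \<in> J. b' j = \<beta>} \<and> \<Phi> \<beta> ` {j \<in> J. b' j = \<beta>} \<subseteq> {i \<in> I. b i = \<beta>} \<and>
      (\<forall>j\<in>{j \<in> J. b' j = \<beta>}. e' j \<le> e (\<Phi> \<beta> j))" ..
  then have \<Phi>: "\<And>\<beta>. inj_on (\<Phi> \<beta>) {j \<in> J. b' j = \<beta>}"
    "\<And>\<beta>. \<Phi> \<beta> ` {j \<in> J. b' j = \<beta>} \<subseteq> {i \<in> I. b i = \<beta>}"
    "\<And>\<beta> j. j \<in> {j \<in> J. b' j = \<beta>} \<Longrightarrow> e' j \<le> e (\<Phi> \<beta> j)" by simp_all
  define \<psi> where "\<psi> j = \<Phi> (b' j) j" for j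
  have \<psi>: "\<psi> j \<in> I \<and> b (\<psi> j) = b' j" if "j \<in> J" for j
    using \<Phi>(2)[of "b' j"] that unfolding \<psi>_def by blast
  have "inj_on \<psi> J"
  proof (rule inj_onI)
    fix i j assume ij: "i \<in> J" "j \<in> J" "\<psi> i = \<psi> j"
    then have "b' i = b' j" using \<psi> by metis
    then show "i = j" using ij \<Phi>(1)[of "b' i"] unfolding \<psi>_def by (auto dest: inj_onD)
  qed
  moreover have "\<psi> ` J \<subseteq> I" using \<psi> by auto
  moreover have "e' j \<le> e (\<psi> j)" if "j \<in> J" for j
    using \<Phi>(3)[of j "b' j"] that unfolding \<psi>_def by simp
  ultimately show ?thesis using \<psi> by blast
qed

text \<open>The multiplicity of a bar \<open>(\<beta>, x)\<close> is the number of bars born at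
  \<open>\<beta>\<close> with death at least \<open>x\<close> minus the number with death above
  \<open>x\<close>. The second number is 0 when \<open>x\<close> is infinite.\<close>

lemma image_mset_bars_eqI:
  fixes b :: "'i \<Rightarrow> real" and e :: "'i \<Rightarrow> ereal" and b' :: "'j \<Rightarrow> real" and e' :: "'j \<Rightarrow> ereal"
  assumes fin: "finite I" "finite J"
    and card: "\<And>\<beta> t. \<beta> \<le> t \<Longrightarrow>
      card {j \<in> J. b' j = \<beta> \<and> ereal t < e' j} = card {i \<in> I. b i = \<beta> \<and> ereal t < e i}"
    and pos: "\<And>i. i \<in> I \<Longrightarrow> ereal (b i) < e i" "\<And>j. j \<in> J \<Longrightarrow> ereal (b' j) < e' j"
  shows "image_mset (\<lambda>i. (b i, e i)) (mset_set I) = image_mset (\<lambda>j. (b' j, e' j)) (mset_set J)"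
proof (rule multiset_eqI)
  fix p :: "real \<times> ereal"
  obtain \<beta> x where p: "p = (\<beta>, x)" by fastforce
  have split: "card {i \<in> K. c i = \<beta> \<and> x \<le> d i} =
      card {i \<in> K. (c i, d i) = p} + card {i \<in> K. c i = \<beta> \<and> x < d i}"
    if "finite K" for K :: "'k set" and c :: "'k \<Rightarrow> real" and d :: "'k \<Rightarrow> ereal"
    using that by (subst card_Un_disjoint[symmetric]) (auto simp: p intro!: arg_cong[of _ _ card])
  have "card {i \<in> I. (b i, e i) = p} = card {j \<in> J. (b' j, e' j) = p}"
  proof (cases "ereal \<beta> < x")
    case True
    have "card {j \<in> J. b' j = \<beta> \<and> x \<le> e' j} = card {i \<in> I. b i = \<beta> \<and> x \<le> e i}"
      using card_death_ge_le[of I J \<beta> b' e' b e x, OF fin _ True] card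
        card_death_ge_le[of J I \<beta> b e b' e' x, OF fin(2,1) _ True]
      by (simp add: order.antisym)
    moreover have "card {j \<in> J. b' j = \<beta> \<and> x < e' j} = card {i \<in> I. b i = \<beta> \<and> x < e i}"
      using card[of \<beta>] True by (cases x) auto
    ultimately show ?thesis using split[OF fin(1), of b e] split[OF fin(2), of b' e'] by simp
  next
    case False
    then have "{i \<in> I. (b i, e i) = p} = {}" "{j \<in> J. (b' j, e' j) = p} = {}"
      using pos by (auto simp: p)
    then show ?thesis by (simp only: card.empty)
  qed
  then show "count (image_mset (\<lambda>i. (b i, e i)) (mset_set I)) p =
      count (image_mset (\<lambda>j. (b' j, e' j)) (mset_set J)) p"
    using fin by (simp add: count_image_mset' conj_commute eq_commute)
qed

text \<open>Links the two ways of counting with multiplicity: by indices of a family and by numbered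
  copies.\<close>

lemma ex_bij_mset_copies:
  assumes "finite I"
  shows "\<exists>h. bij_betw h I (mset_copies (image_mset k (mset_set I))) \<and> (\<forall>i\<in>I. fst (h i) = k i)"
  using assms
proof (induction I)
  case empty
  then show ?case by (auto simp: mset_copies_def bij_betw_def)
next
  case (insert x F)
  let ?M = "image_mset k (mset_set F)"
  obtain h where h: "bij_betw h F (mset_copies ?M)" "\<forall>i\<in>F. fst (h i) = k i"
    using insert.IH by blast
  \<comment> \<open>Copies are numbered from 0, so the old count is the first free number.\<close>
  let ?h = "h(x := (k x, count ?M (k x)))"
  have "mset_copies (image_mset k (mset_set (insert x F))) = insert (k x, count ?M (k x)) (mset_copies ?M)"
    using insert.hyps by (auto simp: mset_copies_def split: if_splits)
  moreover have "(k x, count ?M (k x)) \<notin> mset_copies ?M" by (simp add: mset_copies_def)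
  moreover have "bij_betw ?h F (mset_copies ?M)"
    using h(1) insert.hyps(2) by (subst bij_betw_cong[of F _ h]) auto
  ultimately have "bij_betw ?h (insert x F) (mset_copies (image_mset k (mset_set (insert x F))))"
    using notIn_Un_bij_betw[of x F ?h "mset_copies ?M"] insert.hyps(2) by simp
  moreover have "\<forall>i\<in>insert x F. fst (?h i) = k i" using h(2) by simp
  ultimately show ?case by blast
qed

section \<open>Uniqueness and comparison of barcodes\<close>

lemma (in finite_filtration) is_barcode_unique:
  assumes "is_barcode k X M" "is_barcode k X N"
  shows "M = N"
proof -
  obtain I b e z where dI: "interval_decomposition k X I b e z"
    and M: "M = image_mset (\<lambda>i. (b i, e i)) (mset_set I)"
    using assms(1) unfolding is_barcode_def by blast
  obtain J b' e' z' where dJ: "interval_decomposition k X J b' e' z'"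
    and N: "N = image_mset (\<lambda>j. (b' j, e' j)) (mset_set J)"
    using assms(2) unfolding is_barcode_def by blast
  \<comment> \<open>Surjectivity for the identity map: \<open>c' = c\<close> serves, since
    \<open>c + c = 0\<close>.\<close>
  have self: "\<exists>c'\<in>cycles k (X t). c + c' \<in> boundaries k (X t)" if "c \<in> cycles k (X t)" for t c
    using that by (intro bexI[of _ c]) (simp_all add: boundaries_zero)
  note le = bars_card_le[OF finite_filtration_axioms finite_filtration_axioms subset_refl self]
  show ?thesis
    unfolding M N
  proof (rule image_mset_bars_eqI)
    show "card {j \<in> J. b' j = \<beta> \<and> ereal t < e' j} = card {i \<in> I. b i = \<beta> \<and> ereal t < e i}"
      if "\<beta> \<le> t" for \<beta> t
      using le[OF _ dI dJ that] le[OF _ dJ dI that] by (simp add: order.antisym)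
  qed (use dI dJ in \<open>auto simp: interval_decomposition_def\<close>)
qed

text \<open>A surjection in homology from \<open>X\<close> to \<open>Y\<close> yields an injection
  of barcodes in the opposite direction. It is found on indices and carried to copies by enumerating
  both multisets.\<close>

lemma ex_barcode_injection:
  assumes "finite_filtration V X" "finite_filtration V Y" "\<And>t. X t \<subseteq> Y t"
    and "\<And>t c. c \<in> cycles k (Y t) \<Longrightarrow> \<exists>c'\<in>cycles k (X t). c + c' \<in> boundaries k (Y t)"
    and "is_barcode k X M" "is_barcode k Y N"
  shows "\<exists>\<phi>. inj_on \<phi> (mset_copies N) \<and> \<phi> ` mset_copies N \<subseteq> mset_copies M \<and>
    (\<forall>\<beta> \<delta> n. ((\<beta>, \<delta>), n) \<in> mset_copies N \<longrightarrow>
      (\<exists>\<delta>' m. \<phi> ((\<beta>, \<delta>), n) = ((\<beta>, \<delta>'), m) \<and> \<delta> \<le> \<delta>'))"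
proof -
  obtain I b e z where dI: "interval_decomposition k X I b e z"
    and M: "M = image_mset (\<lambda>i. (b i, e i)) (mset_set I)"
    using assms(5) unfolding is_barcode_def by blast
  obtain J b' e' z' where dJ: "interval_decomposition k Y J b' e' z'"
    and N: "N = image_mset (\<lambda>j. (b' j, e' j)) (mset_set J)"
    using assms(6) unfolding is_barcode_def by blast
  have fin: "finite I" "finite J" using dI dJ unfolding interval_decomposition_def by auto
  have pos: "ereal (b' j) < e' j" if "j \<in> J" for j
    using dJ that unfolding interval_decomposition_def by blast
  have "\<exists>\<psi>. inj_on \<psi> J \<and> \<psi> ` J \<subseteq> I \<and> (\<forall>j\<in>J. b (\<psi> j) = b' j \<and> e' j \<le> e (\<psi> j))"
    using fin bars_card_le[OF assms(1-4) dI dJ] pos by (rule ex_bar_injection)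
  then obtain \<psi> where \<psi>: "inj_on \<psi> J" "\<psi> ` J \<subseteq> I"
    "\<And>j. j \<in> J \<Longrightarrow> b (\<psi> j) = b' j \<and> e' j \<le> e (\<psi> j)"
    by blast
  obtain h where h: "bij_betw h I (mset_copies M)" "\<forall>i\<in>I. fst (h i) = (b i, e i)"
    using ex_bij_mset_copies[OF fin(1), of "\<lambda>i. (b i, e i)"] unfolding M by blast
  obtain h' where h': "bij_betw h' J (mset_copies N)" "\<forall>j\<in>J. fst (h' j) = (b' j, e' j)"
    using ex_bij_mset_copies[OF fin(2), of "\<lambda>j. (b' j, e' j)"] unfolding N by blast
  define q where "q = inv_into J h'"
  have q: "bij_betw q (mset_copies N) J" unfolding q_def using bij_betw_inv_into[OF h'(1)] .
  have h'q: "h' (q x) = x" if "x \<in> mset_copies N" for x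
    using bij_betw_inv_into_right[OF h'(1) that] unfolding q_def .
  have qJ: "q x \<in> J" if "x \<in> mset_copies N" for x using q that by (auto simp: bij_betw_def)
  define \<phi> where "\<phi> = h \<circ> \<psi> \<circ> q"
  have "inj_on \<phi> (mset_copies N)"
    unfolding \<phi>_def using q \<psi>(1,2) h(1)
    by (intro comp_inj_on) (auto simp: bij_betw_def image_comp[symmetric] intro: inj_on_subset)
  moreover have "\<phi> ` mset_copies N \<subseteq> mset_copies M"
  proof (rule image_subsetI)
    fix x assume "x \<in> mset_copies N"
    then have "\<psi> (q x) \<in> I" using qJ \<psi>(2) by blast
    then show "\<phi> x \<in> mset_copies M" using bij_betw_apply[OF h(1)] by (simp add: \<phi>_def)
  qed
  moreover have "\<exists>\<delta>' m. \<phi> ((\<beta>, \<delta>), n) = ((\<beta>, \<delta>'), m) \<and> \<delta> \<le> \<delta>'"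
    if mem: "((\<beta>, \<delta>), n) \<in> mset_copies N" for \<beta> \<delta> n
  proof -
    let ?j = "q ((\<beta>, \<delta>), n)"
    have "(b' ?j, e' ?j) = (\<beta>, \<delta>)" using h'(2) h'q[OF mem] qJ[OF mem] by auto
    moreover have "fst (h (\<psi> ?j)) = (b (\<psi> ?j), e (\<psi> ?j))" using h(2) \<psi>(2) qJ[OF mem] by auto
    ultimately have "fst (h (\<psi> ?j)) = (\<beta>, e (\<psi> ?j))" "\<delta> \<le> e (\<psi> ?j)"
      using \<psi>(3)[OF qJ[OF mem]] by auto
    then show ?thesis unfolding \<phi>_def by (cases "h (\<psi> ?j)") auto
  qed
  ultimately show ?thesis by blast
qed

section \<open>Vietoris--Rips filtrations\<close>

lemma rips_value_le_iff:
  assumes "finite \<sigma>" "\<sigma> \<noteq> {}"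
  shows "rips_value d \<sigma> \<le> t \<longleftrightarrow>
    (if card \<sigma> = 1 then 0 \<le> t else \<forall>v\<in>\<sigma>. \<forall>w\<in>\<sigma>. d v w \<le> t)"
proof -
  have eq: "{d v w | v w. v \<in> \<sigma> \<and> w \<in> \<sigma>} = (\<lambda>(v, w). d v w) ` (\<sigma> \<times> \<sigma>)" by auto
  show ?thesis unfolding rips_value_def eq using assms by auto
qed

lemma mem_rips_complex_iff:
  assumes "finite V"
  shows "\<sigma> \<in> rips_complex V d t \<longleftrightarrow> \<sigma> \<noteq> {} \<and> \<sigma> \<subseteq> V \<and>
    (if card \<sigma> = 1 then 0 \<le> t else \<forall>v\<in>\<sigma>. \<forall>w\<in>\<sigma>. d v w \<le> t)"
  using rips_value_le_iff[of \<sigma> d t] finite_subset[OF _ assms, of \<sigma>]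
  unfolding rips_complex_def by blast

lemma rips_finite_filtration:
  assumes "finite V"
  shows "finite_filtration V (rips_complex V d)"
  using assms by unfold_locales (auto simp: rips_complex_def)

text \<open>Any \<open>s\<close> strictly between \<open>t\<close> and the next element of
  \<open>A\<close> works. With \<open>A\<close> the finite set of filtration values, this shows that
  a Rips filtration stays constant just after each time.\<close>

lemma ex_greater_below:
  assumes "finite A"
  shows "\<exists>s>t. \<forall>a\<in>A. a \<le> s \<longleftrightarrow> a \<le> (t :: real)"
proof -
  define m where "m = Min (insert (t + 1) {a \<in> A. t < a})"
  have fin: "finite (insert (t + 1) {a \<in> A. t < a})" using assms by simp
  have "t < m" unfolding m_def using fin by simp
  then obtain s where s: "t < s" "s < m" using dense by blast
  have "m \<le> a" if "a \<in> A" "t < a" for a unfolding m_def using fin that by simp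
  then show ?thesis using s by (intro exI[of _ s]) force
qed

text \<open>Existence and uniqueness together make the definite description in \<open>bcd\<close>
  meaningful.\<close>

lemma bcd_is_barcode:
  assumes "finite V"
  shows "is_barcode k (rips_complex V d) (bcd k V d)"
proof -
  interpret finite_filtration V "rips_complex V d" using assms by (rule rips_finite_filtration)
  define A where "A = rips_value d ` Pow V"
  have A: "finite A" using assms unfolding A_def by simp
  have "rips_complex V d (Min (insert 0 A) - 1) = {}"
  proof (rule equals0I)
    fix \<sigma> assume "\<sigma> \<in> rips_complex V d (Min (insert 0 A) - 1)"
    then have "rips_value d \<sigma> \<in> A" "rips_value d \<sigma> \<le> Min (insert 0 A) - 1"
      unfolding rips_complex_def A_def by auto
    moreover from this have "Min (insert 0 A) \<le> rips_value d \<sigma>" using A by simp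
    ultimately show False by linarith
  qed
  moreover have "\<exists>s>t. rips_complex V d s = rips_complex V d t" for t
  proof -
    obtain s where s: "t < s" "\<forall>a\<in>A. a \<le> s \<longleftrightarrow> a \<le> t" using ex_greater_below[OF A] by blast
    then have "rips_complex V d s = rips_complex V d t"
      unfolding rips_complex_def A_def by auto
    then show ?thesis using s(1) by blast
  qed
  ultimately have "\<exists>M. is_barcode k (rips_complex V d) M"
    using ex_interval_decomposition unfolding is_barcode_def by blast
  then have "\<exists>!M. is_barcode k (rips_complex V d) M"
    using is_barcode_unique by blast
  then show ?thesis unfolding bcd_def by (rule theI')
qed

section \<open>Replacing edges by paths\<close>

definition single :: "'b \<Rightarrow> 'b \<Rightarrow> bit" where
  "single \<sigma> = (\<lambda>\<tau>. if \<tau> = \<sigma> then 1 else 0)"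

lemma single_mem_chains: "\<sigma> \<in> X \<Longrightarrow> card \<sigma> = Suc k \<Longrightarrow> single \<sigma> \<in> chains k X"
  unfolding chains_def single_def by auto

lemma chain_eq_sum_single:
  assumes "finite {\<sigma>. c \<sigma> \<noteq> 0}"
  shows "c = (\<Sum>\<sigma> | c \<sigma> \<noteq> 0. single \<sigma>)"
proof
  fix \<tau>
  have "(\<Sum>\<sigma> | c \<sigma> \<noteq> 0. single \<sigma>) \<tau> = (\<Sum>\<sigma> | c \<sigma> \<noteq> 0. single \<sigma> \<tau>)"
    using assms by (induction rule: finite_induct) auto
  also have "\<dots> = (if c \<tau> \<noteq> 0 then 1 else 0)"
    using assms unfolding single_def by (subst sum.delta') auto
  finally show "c \<tau> = (\<Sum>\<sigma> | c \<sigma> \<noteq> 0. single \<sigma>) \<tau>" by auto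
qed

lemma boundary_single:
  "boundary (single \<sigma>) \<tau> = (if \<tau> \<noteq> {} \<and> (\<exists>v\<in>\<sigma>. \<tau> = \<sigma> - {v}) then 1 else 0)"
proof -
  have "{\<rho>. single \<sigma> \<rho> \<noteq> 0 \<and> (\<exists>v\<in>\<rho>. \<tau> = \<rho> - {v})} = (if \<exists>v\<in>\<sigma>. \<tau> = \<sigma> - {v} then {\<sigma>} else {})"
    by (auto simp: single_def)
  then show ?thesis unfolding boundary_def by (simp add: single_def)
qed

lemma boundary_single_edge:
  assumes "a \<noteq> b"
  shows "boundary (single {a, b}) = single {a} + single {b}"
proof
  fix \<tau> :: "'a set"
  have "(\<tau> \<noteq> {} \<and> (\<exists>v\<in>{a, b}. \<tau> = {a, b} - {v})) \<longleftrightarrow> \<tau> = {a} \<or> \<tau> = {b}"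
    using assms by auto
  then show "boundary (single {a, b}) \<tau> = (single {a} + single {b}) \<tau>"
    using assms unfolding boundary_single by (auto simp: single_def)
qed

lemma boundary_single_triangle:
  assumes "a \<noteq> b" "b \<noteq> c" "a \<noteq> c"
  shows "boundary (single {a, b, c}) = single {a, b} + single {b, c} + single {a, c}"
proof
  fix \<tau> :: "'a set"
  have "(\<tau> \<noteq> {} \<and> (\<exists>v\<in>{a, b, c}. \<tau> = {a, b, c} - {v})) \<longleftrightarrow>
      \<tau> = {a, b} \<or> \<tau> = {b, c} \<or> \<tau> = {a, c}"
    using assms by auto
  moreover have "{a, b} \<noteq> {b, c}" "{a, b} \<noteq> {a, c}" "{b, c} \<noteq> {a, c}"
    using assms by (auto simp: doubleton_eq_iff)
  ultimately show "boundary (single {a, b, c}) \<tau> = (single {a, b} + single {b, c} + single {a, c}) \<tau>"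
    unfolding boundary_single by (auto simp: single_def)
qed

section \<open>One-dimensional cycles modulo boundaries in a finite complex\<close>

context
  fixes V :: "'a set" and X :: "'a set set"
  assumes finV: "finite V" and X: "X \<subseteq> Pow V"
begin

text \<open>Membership in \<open>cycles\<close> is carried along with membership in
  \<open>boundaries\<close> because it is what later shows that replacing edges turns cycles into
  cycles. Here each vertex lies on two of the three edges and cancels.\<close>

lemma triangle_cycle:
  assumes "{a, b} \<in> X" "{b, c} \<in> X" "{a, c} \<in> X" "{a, b, c} \<in> X" "a \<noteq> b" "b \<noteq> c" "a \<noteq> c"
  shows "single {a, b} + single {b, c} + single {a, c} \<in> boundaries 1 X \<inter> cycles 1 X"
proof
  have "single {a, b, c} \<in> chains (Suc 1) X"
    using assms by (intro single_mem_chains) auto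
  then show "single {a, b} + single {b, c} + single {a, c} \<in> boundaries 1 X"
    unfolding boundaries_def boundary_single_triangle[OF assms(5-7), symmetric] by (rule imageI)
  have ch: "single {a, b} \<in> chains 1 X" "single {b, c} \<in> chains 1 X" "single {a, c} \<in> chains 1 X"
    using assms by (auto intro!: single_mem_chains)
  have ch': "single {a, b} \<in> chains 1 (Pow V)" "single {b, c} \<in> chains 1 (Pow V)" "single {a, c} \<in> chains 1 (Pow V)"
    using ch chains_mono[OF X] by auto
  have "boundary (single {a, b} + single {b, c} + single {a, c})
      = (single {a} + single {b}) + (single {b} + single {c}) + (single {a} + single {c})"
    using boundary_add[OF finV chains_add[OF ch'(1,2)] ch'(3)] boundary_add[OF finV ch'(1,2)]
    by (simp only: boundary_single_edge[OF assms(5)] boundary_single_edge[OF assms(6)]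
        boundary_single_edge[OF assms(7)])
  also have "\<dots> = (single {a} + single {a}) + (single {b} + single {b}) + (single {c} + single {c})"
    by (simp only: ac_simps)
  finally have "boundary (single {a, b} + single {b, c} + single {a, c}) = 0"
    by (simp only: bit_fun_add_self add_0)
  then show "single {a, b} + single {b, c} + single {a, c} \<in> cycles 1 X"
    using ch by (simp add: cycles_def chains_add)
qed

lemma null_cycles_add:
  assumes "x \<in> boundaries 1 X \<inter> cycles 1 X" "y \<in> boundaries 1 X \<inter> cycles 1 X"
  shows "x + y \<in> boundaries 1 X \<inter> cycles 1 X"
  using assms boundaries_add[OF finV X] cycles_add[OF finV X] by blast

text \<open>The path together with its closing edge bounds a fan of triangles based at its first vertex.\<close>

lemma path_homologous_edge:
  assumes "distinct p" "2 \<le> length p" and "\<And>\<sigma>. \<sigma> \<subseteq> set p \<Longrightarrow> \<sigma> \<noteq> {} \<Longrightarrow> \<sigma> \<in> X"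
    and "successively (\<lambda>a b. {a, b} \<in> Y) p"
  shows "\<exists>q\<in>chains 1 Y. single {hd p, last p} + q \<in> boundaries 1 X \<inter> cycles 1 X"
  using assms
proof (induction p rule: rev_induct)
  case (snoc c p)
  show ?case
  proof (cases "length p = 1")
    case True
    then obtain a where p: "p = [a]" by (cases p) auto
    have "single {a, c} \<in> chains 1 Y"
      using snoc.prems p by (intro single_mem_chains) auto
    moreover have "single {a, c} + single {a, c} \<in> boundaries 1 X \<inter> cycles 1 X"
      unfolding bit_fun_add_self using boundaries_zero cycles_zero by blast
    moreover have "hd (p @ [c]) = a" "last (p @ [c]) = c" using p by simp_all
    ultimately show ?thesis by metis
  next
    case False
    then have len: "2 \<le> length p" using snoc.prems(2) by simp
    then have "p \<noteq> []" by auto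
    define a b where "a = hd p" and "b = last p"
    have ab: "a \<in> set p" "b \<in> set p" using \<open>p \<noteq> []\<close> unfolding a_def b_def by auto
    have "a \<noteq> b"
      using len snoc.prems(1) \<open>p \<noteq> []\<close> unfolding a_def b_def
      by (cases p) (auto split: if_splits)
    have "c \<notin> set p" using snoc.prems(1) by simp
    have bc: "{b, c} \<in> Y" and suc: "successively (\<lambda>a b. {a, b} \<in> Y) p"
      using snoc.prems(4) \<open>p \<noteq> []\<close> unfolding b_def successively_append_iff by auto
    have "distinct p" using snoc.prems(1) by simp
    have clique: "\<sigma> \<in> X" if "\<sigma> \<subseteq> set p" "\<sigma> \<noteq> {}" for \<sigma>
      using snoc.prems(3)[of \<sigma>] that by auto
    obtain q where q: "q \<in> chains 1 Y" "single {a, b} + q \<in> boundaries 1 X \<inter> cycles 1 X"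
      using snoc.IH[OF \<open>distinct p\<close> len clique suc] unfolding a_def b_def by blast
    have "b \<noteq> c" using ab \<open>c \<notin> set p\<close> by auto
    then have "single {b, c} \<in> chains 1 Y"
      using bc by (intro single_mem_chains) auto
    then have "q + single {b, c} \<in> chains 1 Y" by (rule chains_add[OF q(1)])
    \<comment> \<open>Gluing on the triangle \<open>{a, b, c}\<close> cancels the old closing edge
      \<open>{a, b}\<close> and leaves the new one, \<open>{a, c}\<close>.\<close>
    moreover have "single {a, b} + single {b, c} + single {a, c} \<in> boundaries 1 X \<inter> cycles 1 X"
      using ab \<open>a \<noteq> b\<close> \<open>b \<noteq> c\<close> \<open>c \<notin> set p\<close> by (intro triangle_cycle snoc.prems(3)) auto
    from null_cycles_add[OF q(2) this]
    have "(single {a, b} + single {a, b}) + (single {a, c} + (q + single {b, c}))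
        \<in> boundaries 1 X \<inter> cycles 1 X"
      by (simp only: ac_simps)
    then have "single {a, c} + (q + single {b, c}) \<in> boundaries 1 X \<inter> cycles 1 X"
      by (simp only: bit_fun_add_self add_0)
    moreover have "hd (p @ [c]) = a" "last (p @ [c]) = c"
      using \<open>p \<noteq> []\<close> unfolding a_def by simp_all
    ultimately show ?thesis by metis
  qed
qed simp

text \<open>A cycle is the sum of its edges. Replacing each edge by its chain \<open>q\<close> in
  \<open>Y\<close> changes the cycle by a sum of null-homologous cycles.\<close>

lemma cycle_homologous:
  assumes edge: "\<And>\<sigma>. \<sigma> \<in> X \<Longrightarrow> card \<sigma> = 2 \<Longrightarrow>
      \<exists>q\<in>chains 1 Y. single \<sigma> + q \<in> boundaries 1 X \<inter> cycles 1 X"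
    and Y: "Y \<subseteq> X" and c: "c \<in> cycles 1 X"
  shows "\<exists>c'\<in>cycles 1 Y. c + c' \<in> boundaries 1 X"
proof -
  let ?S = "{\<sigma>. c \<sigma> \<noteq> 0}"
  have S: "\<sigma> \<in> X \<and> card \<sigma> = 2" if "\<sigma> \<in> ?S" for \<sigma>
    using that c unfolding cycles_def chains_def by auto
  have fin: "finite ?S"
    using S X finV by (intro finite_subset[of ?S "Pow V"]) auto
  have "\<forall>\<sigma>\<in>?S. \<exists>q. q \<in> chains 1 Y \<and> single \<sigma> + q \<in> boundaries 1 X \<inter> cycles 1 X"
    using edge S by blast
  from bchoice[OF this] obtain q where
    "\<forall>\<sigma>\<in>?S. q \<sigma> \<in> chains 1 Y \<and> single \<sigma> + q \<sigma> \<in> boundaries 1 X \<inter> cycles 1 X" ..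
  then have q: "\<And>\<sigma>. \<sigma> \<in> ?S \<Longrightarrow> q \<sigma> \<in> chains 1 Y"
    "\<And>\<sigma>. \<sigma> \<in> ?S \<Longrightarrow> single \<sigma> + q \<sigma> \<in> boundaries 1 X \<inter> cycles 1 X"
    by blast+
  define c' where "c' = sum q ?S"
  have c'Y: "c' \<in> chains 1 Y"
    unfolding c'_def using chains_zero chains_add q(1) by (rule sum_mem_additive)
  have "c + c' = (\<Sum>\<sigma>\<in>?S. single \<sigma> + q \<sigma>)"
    by (simp only: c'_def sum.distrib chain_eq_sum_single[OF fin, symmetric])
  also have "\<dots> \<in> boundaries 1 X \<inter> cycles 1 X"
    using _ null_cycles_add q(2) by (rule sum_mem_additive) (simp add: boundaries_zero cycles_zero)
  finally have cc': "c + c' \<in> boundaries 1 X \<inter> cycles 1 X" .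
  \<comment> \<open>Writing \<open>c'\<close> as the sum of the cycles \<open>c\<close> and
    \<open>c + c'\<close> shows that it is a cycle, although the single chains
    \<open>q \<sigma>\<close> need not be.\<close>
  then have "c + (c + c') \<in> cycles 1 X" using cycles_add[OF finV X c] by blast
  moreover have "c + (c + c') = c'" by (simp only: add.assoc[symmetric] bit_fun_add_self add_0)
  ultimately have "boundary c' = 0" unfolding cycles_def by simp
  then have "c' \<in> cycles 1 Y" using c'Y unfolding cycles_def by simp
  then show ?thesis using cc' by blast
qed

end

section \<open>Cost-dominated distances\<close>

lemma path_edges_subset:
  assumes "p \<in> simple_paths V E v w"
  shows "path_edges p \<subseteq> E"
  using assms unfolding simple_paths_def path_edges_def successively_conv_nth by auto

lemma finite_path_edges: "finite (path_edges p)"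
proof -
  have "path_edges p = (\<lambda>i. {p ! i, p ! Suc i}) ` {i. Suc i < length p}"
    unfolding path_edges_def by auto
  moreover have "finite {i. Suc i < length p}"
    by (rule finite_subset[of _ "{..<length p}"]) auto
  ultimately show ?thesis by simp
qed

lemma path_weight_mono:
  assumes "path_edges p \<subseteq> path_edges q" "\<And>e. e \<in> path_edges q \<Longrightarrow> 0 \<le> W e"
  shows "path_weight W p \<le> path_weight W q"
  unfolding path_weight_def using assms by (intro sum_mono2 finite_path_edges) auto

text \<open>Consistency makes \<open>g a b\<close> a subpath of \<open>g v w\<close>, and weights
  are positive. Hence the vertices of a chosen path have diameter at most the distance of its
  ends.\<close>

lemma path_represented_le:
  assumes G: "weighted_graph V E W" and R: "path_represented_by V E W d g"
    and vw: "v \<in> V" "w \<in> V" "v \<noteq> w" and ab: "a \<in> set (g v w)" "b \<in> set (g v w)"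
  shows "d a b \<le> d v w" "0 \<le> d v w"
proof -
  have g: "g v w \<in> simple_paths V E v w"
    using R vw unfolding path_represented_by_def path_choice_function_def by blast
  have pos: "0 \<le> W e" if "e \<in> path_edges (g v w)" for e
    using path_edges_subset[OF g] that G unfolding weighted_graph_def by (auto intro: less_imp_le)
  have d: "d x y = (if x = y then 0 else path_weight W (g x y))" if "x \<in> V" "y \<in> V" for x y
    using R that unfolding path_represented_by_def by blast
  show nonneg: "0 \<le> d v w"
    using d[OF vw(1,2)] vw(3) pos unfolding path_weight_def by (simp add: sum_nonneg)
  have "subpath (g a b) (g v w)"
    using R vw ab unfolding path_represented_by_def path_choice_function_def by blast
  then have le: "path_weight W (g a b) \<le> path_weight W (g v w)"
    using pos unfolding subpath_def by (intro path_weight_mono) auto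
  have "a \<in> V" "b \<in> V" using ab g unfolding simple_paths_def by auto
  then show "d a b \<le> d v w" using d[of a b] d[OF vw(1,2)] vw(3) le nonneg by auto
qed

lemma cost_dominated_edge_le:
  assumes G: "weighted_graph V E W" and R: "path_represented_by V E W d g"
    and "cost_dominated E W g" and e: "{v, w} \<in> E"
  shows "d v w \<le> W {v, w}"
proof -
  have "v \<in> V" "w \<in> V" "v \<noteq> w" using G e unfolding weighted_graph_def by force+
  then have d: "d v w = path_weight W (g v w)"
    using R unfolding path_represented_by_def by auto
  show ?thesis
  proof (cases "g v w = [v, w]")
    case True
    then have "path_edges (g v w) = {{v, w}}" unfolding path_edges_def by auto
    then show ?thesis using d by (simp add: path_weight_def)
  next
    case False
    then show ?thesis using assms(3) e d unfolding cost_dominated_def by auto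
  qed
qed

lemma rips_complex_antimono:
  assumes "finite V" "\<forall>v\<in>V. \<forall>w\<in>V. d v w \<le> d' v w"
  shows "rips_complex V d' t \<subseteq> rips_complex V d t"
proof
  fix \<sigma> assume "\<sigma> \<in> rips_complex V d' t"
  then show "\<sigma> \<in> rips_complex V d t"
    using assms(2) unfolding mem_rips_complex_iff[OF assms(1)]
    by (auto split: if_splits) (meson order.trans subsetD)
qed

text \<open>Provides the edge replacement required by \<open>cycle_homologous\<close>: an edge of
  the Rips complex of \<open>d\<^sub>i\<close> is traded for the path chosen by
  \<open>g\<^sub>i\<close>, whose edges already lie in that of \<open>d\<^sub>j\<close> at the same
  scale.\<close>

lemma chosen_path_homologous_edge:
  assumes G: "weighted_graph V E W"
    and Ri: "path_represented_by V E W d\<^sub>i g\<^sub>i"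
    and Rj: "path_represented_by V E W d\<^sub>j g\<^sub>j" and cj: "cost_dominated E W g\<^sub>j"
    and \<sigma>: "\<sigma> \<in> rips_complex V d\<^sub>i t" "card \<sigma> = 2"
  shows "\<exists>q\<in>chains 1 (rips_complex V d\<^sub>j t). single \<sigma> + q \<in>
    boundaries 1 (rips_complex V d\<^sub>i t) \<inter> cycles 1 (rips_complex V d\<^sub>i t)"
proof -
  have finV: "finite V" using G unfolding weighted_graph_def by blast
  obtain v w where vw: "\<sigma> = {v, w}" "v \<noteq> w" using \<sigma>(2) by (auto simp: card_2_iff)
  have vwV: "v \<in> V" "w \<in> V" and dt: "d\<^sub>i v w \<le> t"
    using \<sigma> vw unfolding mem_rips_complex_iff[OF finV] by auto
  define p where "p = g\<^sub>i v w"
  have p: "p \<in> simple_paths V E v w"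
    using Ri vwV unfolding p_def path_represented_by_def path_choice_function_def by blast
  then have pp: "p \<noteq> []" "set p \<subseteq> V" "distinct p" "successively (\<lambda>a b. {a, b} \<in> E) p"
    "hd p = v" "last p = w"
    unfolding simple_paths_def by auto
  have d_path: "d\<^sub>i v w = path_weight W p"
    using Ri vwV vw(2) unfolding path_represented_by_def p_def by simp
  have pos: "0 \<le> W e" if "e \<in> path_edges p" for e
    using path_edges_subset[OF p] that G unfolding weighted_graph_def by (auto intro: less_imp_le)
  have clique: "\<tau> \<in> rips_complex V d\<^sub>i t" if \<tau>: "\<tau> \<subseteq> set p" "\<tau> \<noteq> {}" for \<tau>
  proof -
    have "0 \<le> t" using path_represented_le(2)[OF G Ri vwV vw(2)] pp(1) dt unfolding p_def
      by (metis list.set_intros(1) neq_Nil_conv order.trans)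
    moreover have "d\<^sub>i a b \<le> t" if "a \<in> set p" "b \<in> set p" for a b
      using path_represented_le(1)[OF G Ri vwV vw(2)] that dt unfolding p_def by (meson order.trans)
    ultimately show ?thesis
      using \<tau> pp(2) unfolding mem_rips_complex_iff[OF finV] by auto
  qed
  have "successively (\<lambda>a b. {a, b} \<in> rips_complex V d\<^sub>j t) p"
    unfolding successively_conv_nth
  proof (intro allI impI)
    fix i assume i: "Suc i < length p"
    let ?a = "p ! i" and ?b = "p ! Suc i"
    have e: "{?a, ?b} \<in> path_edges p" using i unfolding path_edges_def by auto
    then have eE: "{?a, ?b} \<in> E" "{?b, ?a} \<in> E"
      using path_edges_subset[OF p] by (auto simp: insert_commute)
    \<comment> \<open>One edge weighs at most as much as the whole path, whose weight is
      \<open>d\<^sub>i v w \<le> t\<close>; cost domination of \<open>g\<^sub>j\<close> then bounds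
      the \<open>d\<^sub>j\<close>-length of the edge by its weight.\<close>
    have "W {?a, ?b} \<le> path_weight W p"
      unfolding path_weight_def using e pos by (intro member_le_sum finite_path_edges) auto
    then have "d\<^sub>j ?a ?b \<le> t" "d\<^sub>j ?b ?a \<le> t"
      using cost_dominated_edge_le[OF G Rj cj eE(1)] cost_dominated_edge_le[OF G Rj cj eE(2)]
        dt d_path by (simp_all add: insert_commute)
    moreover have V: "?a \<in> V" "?b \<in> V" using i pp(2) by auto
    \<comment> \<open>Membership in the Rips complex tests all ordered pairs, including equal
      vertices. There the distance is 0, and \<open>0 \<le> d\<^sub>i v w \<le> t\<close>.\<close>
    moreover have "d\<^sub>j x x \<le> t" if "x \<in> V" for x
      using Rj that dt path_represented_le(2)[OF G Ri vwV vw(2)] pp(1)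
      unfolding path_represented_by_def p_def
      by (metis list.set_intros(1) neq_Nil_conv order.trans)
    moreover have "card {?a, ?b} = 2" using eE G unfolding weighted_graph_def by auto
    ultimately show "{?a, ?b} \<in> rips_complex V d\<^sub>j t"
      unfolding mem_rips_complex_iff[OF finV] by auto
  qed
  moreover have "2 \<le> length p"
  proof -
    have "length p \<noteq> 1" using vw(2) pp(5,6) by (cases p) auto
    moreover have "length p \<noteq> 0" using pp(1) by simp
    ultimately show ?thesis by linarith
  qed
  moreover have "rips_complex V d\<^sub>i t \<subseteq> Pow V" unfolding rips_complex_def by auto
  ultimately show ?thesis
    using path_homologous_edge[OF finV _ pp(3) _ clique, of "rips_complex V d\<^sub>j t"] pp(5,6) vw(1)
    by simp
qed

theorem theorem3p4:
  fixes V :: "'a set" and E :: "'a set set" and W :: "'a set \<Rightarrow> real"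
    and d\<^sub>i d\<^sub>j :: "'a \<Rightarrow> 'a \<Rightarrow> real" and g\<^sub>i g\<^sub>j :: "'a \<Rightarrow> 'a \<Rightarrow> 'a list"
  assumes "weighted_graph V E W" and "connected_graph V E"
    and "path_represented_by V E W d\<^sub>i g\<^sub>i" and "cost_dominated E W g\<^sub>i"
    and "path_represented_by V E W d\<^sub>j g\<^sub>j" and "cost_dominated E W g\<^sub>j"
    and "\<forall>v\<in>V. \<forall>w\<in>V. d\<^sub>i v w \<le> d\<^sub>j v w"
  shows "\<exists>\<phi> :: (real \<times> ereal) \<times> nat \<Rightarrow> (real \<times> ereal) \<times> nat.
           inj_on \<phi> (mset_copies (bcd 1 V d\<^sub>i)) \<and>
           \<phi> ` mset_copies (bcd 1 V d\<^sub>i) \<subseteq> mset_copies (bcd 1 V d\<^sub>j) \<and>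
           (\<forall>\<beta> \<delta> n. ((\<beta>, \<delta>), n) \<in> mset_copies (bcd 1 V d\<^sub>i) \<longrightarrow>
              (\<exists>\<delta>' m. \<phi> ((\<beta>, \<delta>), n) = ((\<beta>, \<delta>'), m) \<and> \<delta> \<le> \<delta>'))"
proof (rule ex_barcode_injection)
  have finV: "finite V" using assms(1) unfolding weighted_graph_def by blast
  \<comment> \<open>The smaller filtration \<open>X\<close> is the one of the larger distance
    \<open>d\<^sub>j\<close>, so the injection runs from the bars of \<open>d\<^sub>i\<close> to
    those of \<open>d\<^sub>j\<close>.\<close>
  show "finite_filtration V (rips_complex V d\<^sub>j)" "finite_filtration V (rips_complex V d\<^sub>i)"
    using finV by (rule rips_finite_filtration)+
  show sub: "rips_complex V d\<^sub>j t \<subseteq> rips_complex V d\<^sub>i t" for t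
    using finV assms(7) by (rule rips_complex_antimono)
  show "\<exists>c'\<in>cycles 1 (rips_complex V d\<^sub>j t). c + c' \<in> boundaries 1 (rips_complex V d\<^sub>i t)"
    if "c \<in> cycles 1 (rips_complex V d\<^sub>i t)" for t c
  proof (rule cycle_homologous[OF finV])
    show "rips_complex V d\<^sub>i t \<subseteq> Pow V" unfolding rips_complex_def by auto
  qed (use chosen_path_homologous_edge[OF assms(1,3,5,6)] sub that in auto)
  show "is_barcode 1 (rips_complex V d\<^sub>j) (bcd 1 V d\<^sub>j)" "is_barcode 1 (rips_complex V d\<^sub>i) (bcd 1 V d\<^sub>i)"
    using finV by (rule bcd_is_barcode)+
qed

end
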